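(* Let $R$ be a commutative ring and $c\in R$. Let $V=T_*(\pi_0)^r$ be the $(R\text{-Mod},H_a,S_0)$-vertex algebra obtained by twisting $T_*(\pi_0)$ by the $H_a$-invariant $R[(x_1-x_2)^{\pm1}]$-valued bicharacter $r$ of $\pi_0$ determined by $r(b_{-1}v_0\otimes b_{-1}v_0)=\dfrac{c}{(x_1-x_2)^2}$. Then the ordinary vertex algebra associated to $V$, whose space of fields is $V(\{1\})=\pi_0$, coincides with the Heisenberg vertex algebra over $R$ with central parameter $c$.
   Context: $H_a$ is the commutative cocommutative bialgebra over $R$ with basis $\{D^{(i)}\mid i\ge 0\}$, product $D^{(i)}D^{(j)}=\binom{i+j}{i}D^{(i+j)}$, coproduct $\Delta(D^{(i)})=\sum_{j=0}^i D^{(j)}\otimes D^{(i-j)}$ and counit $\varepsilon(D^{(i)})=\delta_{i,0}$. Space $\pi_0$. Let $\mathfrak c=Rb$ be the one-dimensional commutative Lie algebra, $b_i:=b\otimes t^i\in \mathfrak c\otimes_R R[t^{\pm1}]$, and let $\pi_0$ be the module over $U(\mathfrak c\otimes R[t^{\pm1}])$ induced from the trivial representation $Rv_0$ of $\mathfrak c\otimes R[t]$. It has an $R$-basis of monomials $b_{-i_1}\cdots b_{-i_n}v_0$ ($n\ge 0$, $i_1\ge\dots\ge i_n>0$) and is regarded as the polynomial algebra $R[b_{-1},b_{-2},\dots]v_0$ with unit $v_0$. It is a commutative cocommutative bialgebra in which each $b_{-n}v_0$ is primitive. $H_a$ acts on it by $D^{(i)}(b_{-n}v_0)=\binom{n+i-1}{i}b_{-n-i}v_0$,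 $D^{(i)}v_0=\delta_{i,0}v_0$, and $D^{(i)}(uw)=\sum_{j=0}^i (D^{(j)}u)(D^{(i-j)}w)$. With this structure $\pi_0$ is identified with $H_a(U(\mathfrak c))$, the universal $R$-algebra with a linear map $H_a\otimes U(\mathfrak c)\to H_a(U(\mathfrak c))$, $h\otimes m\mapsto h(m)$, satisfying $h(mn)=\sum h'(m)h''(n)$ and $h(1)=\varepsilon(h)$. Bicharacter. An $A$-valued bicharacter of a bialgebra $M$ ($A$ a commutative $R$-algebra) is an $R$-linear map $r:M\otimes M\to A$ with $r(a\otimes1)=\varepsilon(a)=r(1\otimes a)$, $r(ab\otimes d)=\sum r(a\otimes d')r(b\otimes d'')$, $r(a\otimes bd)=\sum r(a'\otimes b)r(a''\otimes d)$, where $\Delta(a)=\sum a'\otimes a''$. Here $M=\pi_0$, $A=R[(x_1-x_2)^{\pm1}]$, and $H_a$-invariance means $$r(D^{(i)}u\otimes D^{(j)}w)=\frac{\partial_{x_1}^i}{i!}\frac{\partial_{x_2}^j}{j!}\,r(u\otimes w)$$ (divided-power derivatives, defined over any $R$). The value on $b_{-1}v_0\otimes b_{-1}v_0$ determines $r$ uniquely. Twisting. $T_*(\pi_0)$ is the functor $I\mapsto \pi_0^{\otimes I}$ on finite sets (maps act by multiplication and unit). $S_0$ assigns to a finite set $I$ with equivalence relation $\equiv$ the ring $S_0(I)=R[(x_i-x_j)^{\pm1}\mid i\not\equiv j]$. For disjoint finite sets $I,J$ let $I:J$ be $I\sqcup J$ with equivalence classes $I$ and $J$. The twisted singular multiplication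 is $$\pi_0^{\otimes I}\otimes\pi_0^{\otimes J}\to \pi_0^{\otimes (I\sqcup J)}\otimes_R S_0(I:J),\qquad u\odot w=\sum u'w'\,r(u''\otimes w''),$$ where $u'w'$ is the product in $\pi_0^{\otimes(I\sqcup J)}$ and $r(\bigotimes_{i\in I} a_i\otimes\bigotimes_{j\in J} d_j)=\sum\prod_{i\in I}\prod_{j\in J} r(a_i^{(j)}\otimes d_j^{(i)})|_{x_1\to x_i,\,x_2\to x_j}$, with $\sum\bigotimes_{j} a_i^{(j)}$ and $\sum\bigotimes_i d_j^{(i)}$ the iterated coproducts. This makes $T_*(\pi_0)$ into the $(R\text{-Mod},H_a,S_0)$-vertex algebra $V=T_*(\pi_0)^r$ with $V(I)=\pi_0^{\otimes I}$. Associated ordinary vertex algebra. Its space is $V(\{1\})=\pi_0$, its vacuum is $v_0$, its translation operator is $T=D^{(1)}$. For $u,w\in\pi_0$ placed at $\{1\}$ and $\{2\}$, $u\odot w\in \pi_0^{\otimes2}[(x_1-x_2)^{\pm1}]$, and $Y(u,x_1)w$ is obtained by applying to the $\pi_0^{\otimes 2}$-factor the Taylor expansion $p\otimes q\mapsto\sum_{i,j\ge0}(D^{(i)}p)(D^{(j)}q)\,x_1^ix_2^j$ and then setting $x_2=0$, giving an element of $\pi_0[[x_1]][x_1^{-1}]$. Heisenberg vertex algebra with central parameter $c$. Its space is $R[b_{-1},b_{-2},\dots]v_0$ with operators $b_n$ ($n\in\mathbb Z$) satisfying $[b_m,b_n]=c\,m\,\delta_{m+n,0}$ and $b_nv_0=0$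 for $n\ge0$, where $b_{-n}$ ($n>0$) acts by multiplication; the vacuum is $v_0$; the translation $T$ satisfies $Tv_0=0$, $[T,b_n]=-n\,b_{n-1}$; and $Y(b_{-1}v_0,z)=b(z):=\sum_{n}b_nz^{-n-1}$, with $Y(b_{-n_1}\cdots b_{-n_k}v_0,z)$ the normally ordered product of the fields $\frac{\partial_z^{n_i-1}}{(n_i-1)!}b(z)$. *)

theory Defs
  imports
    "HOL-Library.Multiset"
    "HOL-Library.Poly_Mapping"
    "HOL-Library.Product_Plus"
    "HOL-Computational_Algebra.Formal_Laurent_Series"
    "HOL.Binomial_Plus"
begin

section \<open>Free modules and monoid algebras\<close>

text \<open>
  All modules over the commutative ring \<open>R\<close> below are free and come with a basis: \<open>'k \<Rightarrow>\<^sub>0 'r\<close> is the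
  free \<open>R\<close>-module on \<open>'k\<close>. When \<open>'k\<close> is an additive monoid, the multiplication of
  \<^theory>\<open>HOL-Library.Poly_Mapping\<close> makes it the monoid algebra, with
  \<open>basis k * basis l = basis (k + l)\<close> and \<open>R\<close> embedded as \<open>single 0\<close>.
\<close>

alias lookup = Poly_Mapping.lookup
alias keys = Poly_Mapping.keys
alias single = Poly_Mapping.single

abbreviation basis :: "'k \<Rightarrow> ('k \<Rightarrow>\<^sub>0 'r::comm_ring_1)"
  where "basis k \<equiv> single k 1"

definition smul :: "'r::comm_ring_1 \<Rightarrow> ('k::comm_monoid_add \<Rightarrow>\<^sub>0 'r) \<Rightarrow> ('k \<Rightarrow>\<^sub>0 'r)"
  where "smul a p = single 0 a * p"

abbreviation linear_map ::
    "(('k::comm_monoid_add \<Rightarrow>\<^sub>0 'r::comm_ring_1) \<Rightarrow> ('l::comm_monoid_add \<Rightarrow>\<^sub>0 'r)) \<Rightarrow> bool"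
  where "linear_map \<equiv> module_hom smul smul"

text \<open>The linear map with prescribed values on the basis.\<close>

definition lin_ext ::
    "('k \<Rightarrow> ('l::comm_monoid_add \<Rightarrow>\<^sub>0 'r)) \<Rightarrow> ('k \<Rightarrow>\<^sub>0 'r::comm_ring_1) \<Rightarrow> ('l \<Rightarrow>\<^sub>0 'r)"
  where "lin_ext f p = (\<Sum>k\<in>keys p. smul (lookup p k) (f k))"

lemma module_smul: "module (smul :: 'r::comm_ring_1 \<Rightarrow> ('k::comm_monoid_add \<Rightarrow>\<^sub>0 'r) \<Rightarrow> _)"
  by standard (simp_all add: smul_def algebra_simps single_add mult_single flip: mult.assoc)

lemma linear_map_lin_ext:
  fixes f :: "'k::comm_monoid_add \<Rightarrow> ('l::comm_monoid_add \<Rightarrow>\<^sub>0 'r::comm_ring_1)"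
  shows "linear_map (lin_ext f)"
proof -
  interpret module "smul :: 'r \<Rightarrow> ('l \<Rightarrow>\<^sub>0 'r) \<Rightarrow> _"
    by (rule module_smul)
  have superset: "lin_ext f p = (\<Sum>k\<in>K. smul (lookup p k) (f k))"
    if "finite K" "keys p \<subseteq> K" for p K
    unfolding lin_ext_def
    by (rule sum.mono_neutral_left) (use that in \<open>auto simp: in_keys_iff\<close>)
  have "lin_ext f (p + q) = lin_ext f p + lin_ext f q" for p q
    using Poly_Mapping.keys_add[of p q]
    by (simp add: superset[of "keys p \<union> keys q"] lookup_add scale_left_distrib sum.distrib)
  moreover have "lin_ext f (smul a p) = smul a (lin_ext f p)" for a p
  proof -
    have *: "lookup (smul a p) k = a * lookup p k" for k
      unfolding smul_def by (simp flip: mult_map_scale_conv_mult add: Poly_Mapping.map.rep_eq when_def)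
    then have "keys (smul a p) \<subseteq> keys p"
      by (auto simp: in_keys_iff)
    then show ?thesis
      by (simp add: superset[of "keys p"] * scale_sum_right)
  qed
  ultimately show ?thesis
    by (simp add: module_hom_iff module_smul)
qed

lemma lin_ext_single: "lin_ext f (single k a) = smul a (f k)"
  by (cases "a = 0") (auto simp: lin_ext_def smul_def)

lemma smul_one [simp]: "smul 1 p = p"
  by (simp add: smul_def)

lemma linear_map_comp: "linear_map f \<Longrightarrow> linear_map g \<Longrightarrow> linear_map (\<lambda>x. f (g x))"
  by (simp add: module_hom_iff)

lemma linear_map_id: "linear_map (\<lambda>x. x)"
  by (simp add: module_hom_iff module_smul)

lemma linear_map_mult:
  fixes t :: "'k::comm_monoid_add \<Rightarrow>\<^sub>0 'r::comm_ring_1"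
  shows "linear_map (\<lambda>x. t * x)" "linear_map (\<lambda>x. x * t)"
  by (auto simp: module_hom_iff module_smul smul_def algebra_simps)

lemma linear_map_eqI:
  assumes f: "linear_map f" and g: "linear_map g" and eq: "\<And>k. f (basis k) = g (basis k)"
  shows "f p = g p"
proof -
  interpret f: module_hom smul smul f by fact
  interpret g: module_hom smul smul g by fact
  have "p = (\<Sum>k\<in>keys p. smul (lookup p k) (basis k))"
    by (rule poly_mapping_eqI)
      (auto simp: lookup_sum lookup_single smul_def mult_single when_def in_keys_iff)
  then show ?thesis
    by (metis (no_types, lifting) eq f.scale f.sum g.scale g.sum sum.cong)
qed

lemma bilinear_eqI:
  assumes "\<And>q. linear_map (\<lambda>p. F p q)" "\<And>p. linear_map (F p)"
    and "\<And>q. linear_map (\<lambda>p. G p q)" "\<And>p. linear_map (G p)"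
    and "\<And>k l. F (basis k) (basis l) = G (basis k) (basis l)"
  shows "F p q = G p q"
  by (rule linear_map_eqI[where f = "\<lambda>p. F p q" and g = "\<lambda>p. G p q"])
    (use assms in \<open>auto intro: linear_map_eqI[where f = "F _" and g = "G _"]\<close>)

lemma keys_lin_ext:
  fixes f :: "'k \<Rightarrow> ('l::comm_monoid_add \<Rightarrow>\<^sub>0 'r::comm_ring_1)"
  shows "keys (lin_ext f p) \<subseteq> (\<Union>k\<in>keys p. keys (f k))"
proof -
  have "keys (smul a q) \<subseteq> keys q" for a and q :: "'l \<Rightarrow>\<^sub>0 'r"
    using keys_mult[of "single 0 a" q] by (cases "a = 0") (auto simp: smul_def)
  then show ?thesis
    unfolding lin_ext_def by (intro subset_trans[OF keys_sum] UN_mono) auto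
qed

text \<open>
  The polynomial ring in variables indexed by \<open>'x\<close>; a monomial is a finite multiset of variables.
  \<open>mpoly_eval \<iota> \<phi>\<close> is the ring homomorphism extending \<open>\<iota>\<close> on coefficients and \<open>\<phi>\<close> on variables.
\<close>

type_synonym ('x, 'r) mpoly = "'x multiset \<Rightarrow>\<^sub>0 'r"

definition mpoly_eval ::
    "('r \<Rightarrow> 'a) \<Rightarrow> ('x \<Rightarrow> 'a) \<Rightarrow> ('x, 'r::comm_ring_1) mpoly \<Rightarrow> 'a::comm_ring_1"
  where "mpoly_eval \<iota> \<phi> p = (\<Sum>m\<in>keys p. \<iota> (lookup p m) * (\<Prod>x\<in>#m. \<phi> x))"

lemma mpoly_eval_superset:
  assumes "finite K" "keys p \<subseteq> K" "\<iota> 0 = 0"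
  shows "mpoly_eval \<iota> \<phi> p = (\<Sum>m\<in>K. \<iota> (lookup p m) * (\<Prod>x\<in>#m. \<phi> x))"
  unfolding mpoly_eval_def
  by (rule sum.mono_neutral_left) (use assms in \<open>auto simp: in_keys_iff\<close>)

lemma mpoly_eval_add:
  assumes "\<iota> 0 = 0" "\<And>a b. \<iota> (a + b) = \<iota> a + \<iota> b"
  shows "mpoly_eval \<iota> \<phi> (p + q) = mpoly_eval \<iota> \<phi> p + mpoly_eval \<iota> \<phi> q"
proof -
  let ?K = "keys p \<union> keys q"
  have "mpoly_eval \<iota> \<phi> f = (\<Sum>m\<in>?K. \<iota> (lookup f m) * (\<Prod>x\<in>#m. \<phi> x))"
    if "f \<in> {p, q, p + q}" for f
    using that assms Poly_Mapping.keys_add[of p q] by (intro mpoly_eval_superset) auto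
  then show ?thesis
    by (simp add: lookup_add assms(2) distrib_right sum.distrib)
qed

lemma mpoly_eval_single:
  assumes "\<iota> 0 = 0"
  shows "mpoly_eval \<iota> \<phi> (single m a) = \<iota> a * (\<Prod>x\<in>#m. \<phi> x)"
  using assms by (cases "a = 0") (auto simp: mpoly_eval_def)

lemma mpoly_eval_mult:
  fixes p q :: "('x, 'r::comm_ring_1) mpoly"
  assumes z: "\<iota> 0 = 0" and a: "\<And>a b. \<iota> (a + b) = \<iota> a + \<iota> b"
    and m: "\<And>a b. \<iota> (a * b) = \<iota> a * \<iota> b"
  shows "mpoly_eval \<iota> \<phi> (p * q) = mpoly_eval \<iota> \<phi> p * mpoly_eval \<iota> \<phi> q"
proof -
  have expand: "f = (\<Sum>k\<in>keys f. single k (lookup f k))"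
    for f :: "('x, 'r) mpoly"
    by (rule poly_mapping_eqI)
      (auto simp: lookup_sum lookup_single when_def in_keys_iff)
  have ev_zero: "mpoly_eval \<iota> \<phi> 0 = 0"
    by (simp add: mpoly_eval_def)
  have ev_sum: "mpoly_eval \<iota> \<phi> (\<Sum>k\<in>K. h k) = (\<Sum>k\<in>K. mpoly_eval \<iota> \<phi> (h k))"
    if "finite K" for K and h :: "'x multiset \<Rightarrow> ('x, 'r) mpoly"
    using that by induction (simp_all add: mpoly_eval_add[OF z a] ev_zero)
  have "p * q = (\<Sum>k\<in>keys p. \<Sum>l\<in>keys q.
      single (k + l) (lookup p k * lookup q l))"
    by (subst expand[of p], subst expand[of q]) (simp add: sum_product mult_single)
  then have "mpoly_eval \<iota> \<phi> (p * q) = (\<Sum>k\<in>keys p. \<Sum>l\<in>keys q.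
      (\<iota> (lookup p k) * (\<Prod>x\<in>#k. \<phi> x)) * (\<iota> (lookup q l) * (\<Prod>x\<in>#l. \<phi> x)))"
    by (simp add: ev_sum mpoly_eval_single z m mult_ac)
  then show ?thesis
    by (simp add: mpoly_eval_def sum_product)
qed


section \<open>The bialgebra $\pi_0$\<close>

text \<open>
  \<open>\<pi>\<^sub>0\<close> is the polynomial ring in \<open>b\<^sub>-\<^sub>1, b\<^sub>-\<^sub>2, \<dots>\<close>, with \<open>v\<^sub>0 = 1\<close>. The variable with index \<open>k\<close>
  is \<open>b\<^bsub>-(k+1)\<^esub>\<close>; this shift is confined to the definitions of \<open>bneg\<close>, \<open>pi0_coprod\<close> and
  \<open>hasse_series\<close>. \<open>bneg n\<close> is \<open>b\<^bsub>-n\<^esub>v\<^sub>0\<close> and is only used for \<open>n \<ge> 1\<close>.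
\<close>

type_synonym 'r pi0 = "(nat, 'r) mpoly"

definition bneg :: "nat \<Rightarrow> 'r::comm_ring_1 pi0"
  where "bneg n = basis {#n - 1#}"

text \<open>\<open>\<pi>\<^sub>0 \<otimes> \<pi>\<^sub>0\<close> has the basis of pairs of monomials.\<close>

definition pi0_coprod ::
    "'r::comm_ring_1 pi0 \<Rightarrow> (nat multiset \<times> nat multiset \<Rightarrow>\<^sub>0 'r)"
  where "pi0_coprod = mpoly_eval (single 0)
    (\<lambda>k. basis ({#k#}, 0) + basis (0, {#k#}))"

definition pi0_counit :: "'r::comm_ring_1 pi0 \<Rightarrow> 'r"
  where "pi0_counit = mpoly_eval (\<lambda>a. a) (\<lambda>_. 0)"

text \<open>
  The sum \<open>\<Sum>\<^sub>i D\<^sup>(\<^sup>i\<^sup>)u x\<^sup>i\<close>. The Leibniz rule says precisely that it is multiplicative in \<open>u\<close>;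
  the formulas characterising the action of \<open>H\<^sub>a\<close> are the lemmas \<open>hasse_linear\<close>, \<open>hasse_one\<close>,
  \<open>hasse_bneg\<close> and \<open>hasse_mult\<close>.
\<close>

definition hasse_series :: "'r::comm_ring_1 pi0 \<Rightarrow> 'r pi0 fps"
  where "hasse_series = mpoly_eval (\<lambda>a. fps_const (single 0 a))
    (\<lambda>k. Abs_fps (\<lambda>i. of_nat ((k + i) choose i) * bneg (k + 1 + i)))"

definition hasse :: "nat \<Rightarrow> 'r::comm_ring_1 pi0 \<Rightarrow> 'r pi0"
  where "hasse i u = fps_nth (hasse_series u) i"

lemma pi0_coprod_mult: "pi0_coprod (u * w) = pi0_coprod u * pi0_coprod w"
  unfolding pi0_coprod_def
  by (rule mpoly_eval_mult) (simp_all add: single_add mult_single)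

lemma pi0_coprod_linear: "linear_map pi0_coprod"
proof -
  have "pi0_coprod (u + w) = pi0_coprod u + pi0_coprod w" for u w :: "'a pi0"
    unfolding pi0_coprod_def by (rule mpoly_eval_add) (simp_all add: single_add)
  moreover have "pi0_coprod (smul a u) = smul a (pi0_coprod u)" for a and u :: "'a pi0"
    unfolding smul_def pi0_coprod_mult
    by (simp add: pi0_coprod_def mpoly_eval_single)
  ultimately show ?thesis
    by (simp add: module_hom_iff module_smul)
qed

lemma pi0_coprod_bneg:
  "pi0_coprod (bneg n) = basis ({#n - 1#}, 0) + basis (0, {#n - 1#})"
  by (simp add: pi0_coprod_def bneg_def mpoly_eval_single)

lemma hasse_series_mult: "hasse_series (u * w) = hasse_series u * hasse_series w"
  unfolding hasse_series_def
  by (rule mpoly_eval_mult)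
    (simp_all add: single_add mult_single mult.commute flip: fps_const_add fps_const_mult)

lemma hasse_mult: "hasse i (u * w) = (\<Sum>j\<le>i. hasse j u * hasse (i - j) w)"
  by (simp add: hasse_def hasse_series_mult fps_mult_nth atLeast0AtMost)

lemma hasse_linear: "linear_map (hasse i)"
proof -
  have "hasse i (u + w) = hasse i u + hasse i w" for u w :: "'a pi0"
    unfolding hasse_def hasse_series_def
    by (subst mpoly_eval_add) (simp_all add: single_add flip: fps_const_add)
  moreover have "hasse i (smul a u) = smul a (hasse i u)" for a and u :: "'a pi0"
    unfolding smul_def hasse_def hasse_series_mult
    by (simp add: hasse_series_def mpoly_eval_single)
  ultimately show ?thesis
    by (simp add: module_hom_iff module_smul)
qed

lemma hasse_one: "hasse i 1 = (if i = 0 then 1 else 0)"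
proof -
  have "hasse_series (1 :: 'a pi0) = 1"
    by (simp add: hasse_series_def mpoly_eval_single flip: single_one)
  then show ?thesis
    by (simp add: hasse_def)
qed

lemma hasse_bneg:
  "n \<ge> 1 \<Longrightarrow> hasse i (bneg n) = of_nat ((n + i - 1) choose i) * bneg (n + i)"
  by (simp add: hasse_def hasse_series_def bneg_def mpoly_eval_single)


section \<open>Bicharacters\<close>

text \<open>\<open>R[(x\<^sub>1 - x\<^sub>2)\<^sup>\<plusminus>\<^sup>1]\<close>: the basis element \<open>n\<close> is \<open>(x\<^sub>1 - x\<^sub>2)\<^sup>n\<close>.\<close>

type_synonym 'r laurent = "int \<Rightarrow>\<^sub>0 'r"

text \<open>
  The integral binomial coefficient, with the defining formula of \<^const>\<open>gbinomial\<close> (whose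
  syntax is restricted to fields of characteristic 0). The division is exact.
\<close>

definition int_binomial :: "int \<Rightarrow> nat \<Rightarrow> int"
  where "int_binomial n k = (\<Prod>i = 0..<k. n - int i) div fact k"

lemma int_binomial_mult_fact: "fact k * int_binomial n k = (\<Prod>i = 0..<k. n - int i)"
  using gbinomial_int_mult_fact[of k n] by (simp only: gbinomial_prod_rev int_binomial_def)

text \<open>The divided-power derivatives \<open>\<partial>\<^sub>x\<^sub>1\<^sup>i / i!\<close> and \<open>\<partial>\<^sub>x\<^sub>2\<^sup>j / j!\<close>.\<close>

definition ddx1 :: "nat \<Rightarrow> 'r::comm_ring_1 laurent \<Rightarrow> 'r laurent"
  where "ddx1 i = lin_ext (\<lambda>n. single (n - int i) (of_int (int_binomial n i)))"

definition ddx2 :: "nat \<Rightarrow> 'r::comm_ring_1 laurent \<Rightarrow> 'r laurent"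
  where "ddx2 j = lin_ext (\<lambda>n. single (n - int j) ((-1) ^ j * of_int (int_binomial n j)))"

text \<open>
  In Sweedler notation, \<open>lin_ext (\<lambda>(p, q). F (basis p) (basis q)) (pi0_coprod a)\<close> is
  \<open>\<Sum> F a' a''\<close> for bilinear \<open>F\<close>.
\<close>

definition bicharacter :: "('r::comm_ring_1 pi0 \<Rightarrow> 'r pi0 \<Rightarrow> 'r laurent) \<Rightarrow> bool"
  where "bicharacter r \<longleftrightarrow>
    (\<forall>d. linear_map (\<lambda>a. r a d)) \<and> (\<forall>a. linear_map (r a)) \<and>
    (\<forall>a. r a 1 = single 0 (pi0_counit a)) \<and>
    (\<forall>a. r 1 a = single 0 (pi0_counit a)) \<and>
    (\<forall>a b d. r (a * b) d =
      lin_ext (\<lambda>(d', d''). r a (basis d') * r b (basis d'')) (pi0_coprod d)) \<and>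
    (\<forall>a b d. r a (b * d) =
      lin_ext (\<lambda>(a', a''). r (basis a') b * r (basis a'') d) (pi0_coprod a))"

definition Ha_invariant :: "('r::comm_ring_1 pi0 \<Rightarrow> 'r pi0 \<Rightarrow> 'r laurent) \<Rightarrow> bool"
  where "Ha_invariant r \<longleftrightarrow>
    (\<forall>i j u w. r (hasse i u) (hasse j w) = ddx1 i (ddx2 j (r u w)))"


section \<open>The rings $S_0(I)$\<close>

text \<open>
  Finite sets are finite sets of natural numbers. All the rings \<open>S\<^sub>0(I)\<close> are subrings of one ring,
  the localisation of \<open>R[x\<^sub>0, x\<^sub>1, \<dots>]\<close> at the products of differences \<open>x\<^sub>i - x\<^sub>j\<close>, \<open>i \<noteq> j\<close>. These
  products are not zero divisors, whatever \<open>R\<close> is (\<open>denom_cancel\<close>).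
\<close>

abbreviation xvar :: "nat \<Rightarrow> (nat, 'r::comm_ring_1) mpoly"
  where "xvar i \<equiv> basis {#i#}"

inductive_set denoms :: "(nat, 'r::comm_ring_1) mpoly set" where
  denoms_one: "1 \<in> denoms"
| denoms_diff: "s \<in> denoms \<Longrightarrow> i \<noteq> j \<Longrightarrow> (xvar i - xvar j) * s \<in> denoms"

lemma denoms_mult: "s \<in> denoms \<Longrightarrow> t \<in> denoms \<Longrightarrow> s * t \<in> denoms"
  by (induction rule: denoms.induct) (auto simp: mult.assoc intro: denoms.intros)

lemma lookup_basis_mult:
  "lookup (basis m * p) n = (if m \<subseteq># n then lookup p (n - m) else 0)"
  for p :: "('x, 'r::comm_ring_1) mpoly"
proof -
  have "lookup (basis m * p) n =
      (\<Sum>l. (1 when m = l) * (\<Sum>q. lookup p q when n = l + q))"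
    by (simp add: lookup_mult lookup_single)
  also have "\<dots> = (\<Sum>q. lookup p q when n = m + q)"
    by (simp add: when_mult)
  also have "\<dots> = (if m \<subseteq># n then lookup p (n - m) else 0)"
  proof (cases "m \<subseteq># n")
    case True
    then have "n = m + q \<longleftrightarrow> q = n - m" for q
      by auto
    then show ?thesis
      using True by simp
  next
    case False
    then have "n \<noteq> m + q" for q
      by auto
    then show ?thesis
      using False by simp
  qed
  finally show ?thesis .
qed

lemma xvar_diff_cancel:
  assumes "(xvar i - xvar j) * p = 0" "i \<noteq> j"
  shows "p = (0 :: (nat, 'r::comm_ring_1) mpoly)"
proof (rule ccontr)
  assume "p \<noteq> 0"
  then have ne: "keys p \<noteq> {}"
    by simp
  define N where "N = Max ((\<lambda>m. count m i) ` keys p)"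
  have "N \<in> (\<lambda>m. count m i) ` keys p"
    unfolding N_def using ne by (intro Max_in) auto
  then obtain m where m: "m \<in> keys p" "count m i = N"
    by auto
  let ?n = "add_mset i m"
  have "lookup p (?n - {#j#}) = 0"
  proof (rule ccontr)
    assume "lookup p (?n - {#j#}) \<noteq> 0"
    then have "count (?n - {#j#}) i \<in> (\<lambda>m. count m i) ` keys p"
      by (intro imageI) (simp add: in_keys_iff)
    then have "count (?n - {#j#}) i \<le> N"
      unfolding N_def by (intro Max_ge) auto
    then show False
      using m assms(2) by simp
  qed
  then have "lookup ((xvar i - xvar j) * p) ?n = lookup p m"
    by (simp add: left_diff_distrib lookup_minus lookup_basis_mult)
  then show False
    using assms m by (simp add: in_keys_iff)
qed

lemma denom_cancel: "s \<in> denoms \<Longrightarrow> s * p = 0 \<Longrightarrow> p = 0"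
  by (induction arbitrary: p rule: denoms.induct) (auto simp: mult.assoc dest: xvar_diff_cancel)

lemma denom_cancel_eq: "s \<in> denoms \<Longrightarrow> s * p = s * q \<longleftrightarrow> p = q"
  using denom_cancel[of s "p - q"] by (auto simp: right_diff_distrib)

definition locrel ::
    "(nat, 'r::comm_ring_1) mpoly \<times> (nat, 'r) mpoly \<Rightarrow> (nat, 'r) mpoly \<times> (nat, 'r) mpoly \<Rightarrow> bool"
  where "locrel x y \<longleftrightarrow> snd x \<in> denoms \<and> snd y \<in> denoms \<and> fst x * snd y = fst y * snd x"

lemma part_equivp_locrel: "part_equivp locrel"
proof (rule part_equivpI)
  show "\<exists>x. locrel x x"
    by (rule exI[of _ "(0, 1)"]) (simp add: locrel_def denoms_one)
  show "symp locrel"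
    by (auto simp: symp_def locrel_def)
  show "transp locrel"
  proof (rule transpI)
    fix x y z :: "(nat, 'r::comm_ring_1) mpoly \<times> (nat, 'r) mpoly"
    assume xy: "locrel x y" and yz: "locrel y z"
    have "snd y * (fst x * snd z) = (fst x * snd y) * snd z"
      by (simp add: mult_ac)
    also have "\<dots> = (fst y * snd z) * snd x"
      using xy by (simp add: locrel_def mult_ac)
    also have "\<dots> = snd y * (fst z * snd x)"
      using yz by (simp add: locrel_def mult_ac)
    finally show "locrel x z"
      using xy yz by (simp add: locrel_def denom_cancel_eq)
  qed
qed

lifting_forget poly_mapping.lifting

quotient_type (overloaded) 'r dloc =
  "(nat, 'r::comm_ring_1) mpoly \<times> (nat, 'r) mpoly" / partial: locrel
  by (rule part_equivp_locrel)

text \<open>The fraction \<open>p / s\<close>; the value is junk unless \<open>s \<in> denoms\<close>.\<close>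

lift_definition dfrac :: "(nat, 'r::comm_ring_1) mpoly \<Rightarrow> (nat, 'r) mpoly \<Rightarrow> 'r dloc"
  is "\<lambda>p s. if s \<in> denoms then (p, s) else (0, 1)"
  by (auto simp: locrel_def denoms_one)

lemma dfrac_cases:
  obtains p s where "q = dfrac p s" "s \<in> denoms"
  by transfer (auto simp: locrel_def split: prod.splits)

lemma dfrac_eq:
  "s \<in> denoms \<Longrightarrow> t \<in> denoms \<Longrightarrow> dfrac p s = dfrac q t \<longleftrightarrow> p * t = q * s"
  by transfer (simp add: locrel_def)

instantiation dloc :: (comm_ring_1) comm_ring_1
begin

lift_definition zero_dloc :: "'a dloc" is "(0, 1)"
  by (simp add: locrel_def denoms_one)

lift_definition one_dloc :: "'a dloc" is "(1, 1)"
  by (simp add: locrel_def denoms_one)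

lift_definition plus_dloc :: "'a dloc \<Rightarrow> 'a dloc \<Rightarrow> 'a dloc"
  is "\<lambda>x y. (fst x * snd y + fst y * snd x, snd x * snd y)"
proof -
  fix x x' y y' :: "(nat, 'a) mpoly \<times> (nat, 'a) mpoly"
  assume A: "locrel x x'" "locrel y y'"
  have "(fst x * snd y + fst y * snd x) * (snd x' * snd y') =
      (fst x * snd x') * (snd y * snd y') + (fst y * snd y') * (snd x * snd x')"
    by (simp add: algebra_simps)
  also have "\<dots> = (fst x' * snd y' + fst y' * snd x') * (snd x * snd y)"
    using A by (simp add: locrel_def algebra_simps)
  finally show "locrel (fst x * snd y + fst y * snd x, snd x * snd y)
      (fst x' * snd y' + fst y' * snd x', snd x' * snd y')"
    using A by (simp add: locrel_def denoms_mult)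
qed

lift_definition uminus_dloc :: "'a dloc \<Rightarrow> 'a dloc" is "\<lambda>x. (- fst x, snd x)"
  by (simp add: locrel_def)

definition minus_dloc :: "'a dloc \<Rightarrow> 'a dloc \<Rightarrow> 'a dloc"
  where "minus_dloc x y = x + (- y)"

lift_definition times_dloc :: "'a dloc \<Rightarrow> 'a dloc \<Rightarrow> 'a dloc"
  is "\<lambda>x y. (fst x * fst y, snd x * snd y)"
proof -
  fix x x' y y' :: "(nat, 'a) mpoly \<times> (nat, 'a) mpoly"
  assume A: "locrel x x'" "locrel y y'"
  have "fst x * fst y * (snd x' * snd y') = (fst x * snd x') * (fst y * snd y')"
    by (simp add: mult_ac)
  also have "\<dots> = fst x' * fst y' * (snd x * snd y)"
    using A by (simp add: locrel_def mult_ac)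
  finally show "locrel (fst x * fst y, snd x * snd y) (fst x' * fst y', snd x' * snd y')"
    using A by (simp add: locrel_def denoms_mult)
qed

lemma dfrac_zero: "0 = dfrac 0 1"
  by transfer (simp add: locrel_def denoms_one)

lemma dfrac_one: "1 = dfrac 1 1"
  by transfer (simp add: locrel_def denoms_one)

lemma dfrac_add:
  "s \<in> denoms \<Longrightarrow> t \<in> denoms \<Longrightarrow> dfrac p s + dfrac q t = dfrac (p * t + q * s) (s * t)"
  by transfer (simp add: locrel_def denoms_mult)

lemma dfrac_uminus: "s \<in> denoms \<Longrightarrow> - dfrac p s = dfrac (- p) s"
  by transfer (simp add: locrel_def)

lemma dfrac_mult:
  "s \<in> denoms \<Longrightarrow> t \<in> denoms \<Longrightarrow> dfrac p s * dfrac q t = dfrac (p * q) (s * t)"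
  by transfer (simp add: locrel_def denoms_mult)

instance
proof
  note simps = dfrac_zero dfrac_one dfrac_add dfrac_mult dfrac_uminus minus_dloc_def
    dfrac_eq denoms_mult denoms_one algebra_simps
  fix a b c :: "'a dloc"
  obtain p s q t u v where abc: "a = dfrac p s" "b = dfrac q t" "c = dfrac u v"
    "s \<in> denoms" "t \<in> denoms" "v \<in> denoms"
    by (meson dfrac_cases)
  show "a + b + c = a + (b + c)" "a + b = b + a" "0 + a = a" "- a + a = 0" "a - b = a + - b"
    "a * b * c = a * (b * c)" "a * b = b * a" "1 * a = a" "(a + b) * c = a * c + b * c"
    using abc by (simp_all add: simps)
  show "(0 :: 'a dloc) \<noteq> 1"
    by (simp add: simps)
qed

end

definition dloc_const :: "'r::comm_ring_1 \<Rightarrow> 'r dloc"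
  where "dloc_const a = dfrac (single 0 a) 1"

text \<open>\<open>(x\<^sub>i - x\<^sub>j)\<^sup>n\<close> for integral \<open>n\<close> and \<open>i \<noteq> j\<close>.\<close>

definition diff_pow :: "nat \<Rightarrow> nat \<Rightarrow> int \<Rightarrow> 'r::comm_ring_1 dloc"
  where "diff_pow i j n =
    (if n \<ge> 0 then dfrac ((xvar i - xvar j) ^ nat n) 1 else dfrac 1 ((xvar i - xvar j) ^ nat (- n)))"

text \<open>\<open>S\<^sub>0(I)\<close> for the equivalence relation \<open>E\<close> on \<open>I\<close>.\<close>

inductive_set S0 :: "nat set \<Rightarrow> (nat \<times> nat) set \<Rightarrow> 'r::comm_ring_1 dloc set" for I E where
  S0_const: "dloc_const a \<in> S0 I E"
| S0_diff: "i \<in> I \<Longrightarrow> j \<in> I \<Longrightarrow> (i, j) \<notin> E \<Longrightarrow> diff_pow i j n \<in> S0 I E"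
| S0_add: "f \<in> S0 I E \<Longrightarrow> g \<in> S0 I E \<Longrightarrow> f + g \<in> S0 I E"
| S0_mult: "f \<in> S0 I E \<Longrightarrow> g \<in> S0 I E \<Longrightarrow> f * g \<in> S0 I E"

lemma dloc_const_0: "dloc_const 0 = 0"
  by (simp add: dloc_const_def dfrac_zero)

lemma S0_zero: "0 \<in> S0 I E"
  using S0_const[of 0] by (simp add: dloc_const_0)

lemma S0_one: "1 \<in> S0 I E"
  using S0_const[of 1] by (simp add: dloc_const_def dfrac_one)

lemma S0_sum: "(\<And>x. x \<in> X \<Longrightarrow> f x \<in> S0 I E) \<Longrightarrow> sum f X \<in> S0 I E"
  by (induction X rule: infinite_finite_induct) (auto intro: S0_zero S0_add)

lemma S0_prod: "(\<And>x. x \<in> X \<Longrightarrow> f x \<in> S0 I E) \<Longrightarrow> prod f X \<in> S0 I E"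
  by (induction X rule: infinite_finite_induct) (auto intro: S0_one S0_mult)

text \<open>\<open>S\<^sub>0(I : J)\<close>\<close>

abbreviation S0_colon :: "nat set \<Rightarrow> nat set \<Rightarrow> 'r::comm_ring_1 dloc set"
  where "S0_colon I J \<equiv> S0 (I \<union> J) (I \<times> I \<union> J \<times> J)"

text \<open>The substitution \<open>x\<^sub>1 \<rightarrow> x\<^sub>i, x\<^sub>2 \<rightarrow> x\<^sub>j\<close>.\<close>

definition laurent_subst :: "nat \<Rightarrow> nat \<Rightarrow> 'r::comm_ring_1 laurent \<Rightarrow> 'r dloc"
  where "laurent_subst i j f =
    (\<Sum>n\<in>keys f. dloc_const (lookup f n) * diff_pow i j n)"

lemma laurent_subst_S0:
  "i \<in> I \<Longrightarrow> j \<in> J \<Longrightarrow> I \<inter> J = {} \<Longrightarrow> laurent_subst i j f \<in> S0_colon I J"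
  unfolding laurent_subst_def by (intro S0_sum S0_mult S0_const S0_diff) auto


section \<open>Tensor powers of $\pi_0$\<close>

text \<open>
  The basis element \<open>k :: 'i \<Rightarrow>\<^sub>0 nat multiset\<close> is the pure tensor whose factor at position \<open>i\<close> is the
  monomial \<open>lookup k i\<close>, the empty multiset being \<open>v\<^sub>0\<close>. The tensor power \<open>\<pi>\<^sub>0\<^bsup>\<otimes>I\<^esup>\<close> is spanned by the
  \<open>k\<close> with \<open>keys k \<subseteq> I\<close>, and its product is the product of the monoid algebra.
\<close>

type_synonym 'i tkey = "'i \<Rightarrow>\<^sub>0 nat multiset"
type_synonym ('i, 'r) tens = "'i tkey \<Rightarrow>\<^sub>0 'r"

definition tensor_power :: "'i set \<Rightarrow> ('i, 'r::comm_ring_1) tens set"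
  where "tensor_power I = {t. \<forall>k\<in>keys t. keys k \<subseteq> I}"

definition place :: "'i \<Rightarrow> 'r::comm_ring_1 pi0 \<Rightarrow> ('i, 'r) tens"
  where "place i = lin_ext (\<lambda>m. basis (single i m))"

text \<open>The inverse of \<open>place i :: \<pi>\<^sub>0 \<rightarrow> \<pi>\<^sub>0\<^bsup>\<otimes>{i}\<^esup>\<close>.\<close>

definition unplace :: "'i \<Rightarrow> ('i, 'r::comm_ring_1) tens \<Rightarrow> 'r pi0"
  where "unplace i = Poly_Mapping.map_key (single i)"

text \<open>
  \<open>T\<^sub>*(\<pi>\<^sub>0)\<close> on a map \<open>f\<close> of finite sets: the factors in a fibre of \<open>f\<close> are multiplied, an empty fibre
  contributes \<open>v\<^sub>0\<close>.
\<close>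

definition tens_map :: "('i \<Rightarrow> 'j) \<Rightarrow> ('i, 'r::comm_ring_1) tens \<Rightarrow> ('j, 'r) tens"
  where "tens_map f =
    lin_ext (\<lambda>k. basis (\<Sum>i\<in>keys k. single (f i) (lookup k i)))"

text \<open>\<open>D\<^sup>(\<^sup>n\<^sup>)\<close> acting on the factor at position \<open>i\<close>.\<close>

definition tens_hasse :: "'i \<Rightarrow> nat \<Rightarrow> ('i, 'r::comm_ring_1) tens \<Rightarrow> ('i, 'r) tens"
  where "tens_hasse i n =
    lin_ext (\<lambda>k. place i (hasse n (basis (lookup k i))) * basis (Poly_Mapping.update i 0 k))"

text \<open>The coproduct of the tensor product bialgebra.\<close>

definition tens_coprod :: "('i, 'r::comm_ring_1) tens \<Rightarrow> ('i tkey \<times> 'i tkey \<Rightarrow>\<^sub>0 'r)"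
  where "tens_coprod = lin_ext (\<lambda>k. \<Prod>i\<in>keys k.
    lin_ext (\<lambda>(p, q). basis (single i p, single i q))
      (pi0_coprod (basis (lookup k i))))"

text \<open>The iterated coproduct, with one tensor factor for each entry of the list.\<close>

fun iter_coprod :: "'i list \<Rightarrow> 'r::comm_ring_1 pi0 \<Rightarrow> ('i, 'r) tens" where
  "iter_coprod [] a = single 0 (pi0_counit a)"
| "iter_coprod (j # js) a =
    lin_ext (\<lambda>(p, q). place j (basis p) * iter_coprod js (basis q)) (pi0_coprod a)"

lemma place_basis: "place i (basis m) = basis (single i m)"
  by (simp add: place_def lin_ext_single)

lemma linear_map_place: "linear_map (place i)"
  unfolding place_def by (rule linear_map_lin_ext)

lemma linear_map_unplace: "linear_map (unplace i :: ('i, 'r::comm_ring_1) tens \<Rightarrow> _)"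
proof -
  have inj: "inj (single i)" by simp
  have "unplace i (smul a t) = smul a (unplace i t)" for a and t :: "('i, 'r) tens"
    by (rule poly_mapping_eqI) (simp add: unplace_def smul_def Poly_Mapping.map_key.rep_eq inj
        when_def Poly_Mapping.map.rep_eq flip: mult_map_scale_conv_mult)
  then show ?thesis
    by (simp add: module_hom_iff module_smul unplace_def Poly_Mapping.map_key_plus inj)
qed

lemma unplace_place: "unplace i (place i p) = p"
proof (rule linear_map_eqI[where f = "\<lambda>p. unplace i (place i p)" and g = "\<lambda>p. p"])
  show "linear_map (\<lambda>p. unplace i (place i p))"
    by (rule linear_map_comp[OF linear_map_unplace linear_map_place])
  show "linear_map (\<lambda>p. p)"
    by (rule linear_map_id)
  show "unplace i (place i (basis m)) = basis m" for m
    by (simp add: place_basis unplace_def)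
qed

lemma update_place: "Poly_Mapping.update i 0 (single i m + k) = k"
  if "lookup k i = {#}" for k :: "'i tkey"
  using that by (intro poly_mapping_eqI) (auto simp: lookup_update lookup_add lookup_single when_def)

lemma tens_hasse_place:
  assumes "i \<noteq> j"
  shows "tens_hasse i n (place i p * place j q) = place i (hasse n p) * place j q"
proof (rule bilinear_eqI[where F = "\<lambda>p q. tens_hasse i n (place i p * place j q)"
      and G = "\<lambda>p q. place i (hasse n p) * place j q"])
  fix k l :: "nat multiset"
  show "tens_hasse i n (place i (basis k) * place j (basis l)) =
      place i (hasse n (basis k)) * place j (basis l)"
    using assms
    by (simp add: place_basis tens_hasse_def lin_ext_single mult_single lookup_add lookup_single
        update_place)
qed (unfold tens_hasse_def, (rule linear_map_id linear_map_comp[OF linear_map_mult(1)]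
  linear_map_comp[OF linear_map_mult(2)] linear_map_comp[OF linear_map_lin_ext]
  linear_map_comp[OF linear_map_place] linear_map_comp[OF hasse_linear])+)

lemma tens_map_place:
  assumes "i \<noteq> j"
  shows "tens_map (\<lambda>_. l) (place i p * place j q) = place l (p * q)"
proof (rule bilinear_eqI[where F = "\<lambda>p q. tens_map (\<lambda>_. l) (place i p * place j q)"
      and G = "\<lambda>p q. place l (p * q)"])
  fix k k' :: "nat multiset"
  have "(\<Sum>x\<in>keys (single i k + single j k'). single l (lookup (single i k + single j k') x)) =
      (\<Sum>x\<in>{i, j}. single l (lookup (single i k + single j k') x))"
    using Poly_Mapping.keys_add[of "single i k" "single j k'"]
    by (intro sum.mono_neutral_left) (auto simp: in_keys_iff lookup_add lookup_single when_def split: if_splits)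
  also have "\<dots> = single l (k + k')"
    using assms by (simp add: lookup_add lookup_single single_add)
  finally show "tens_map (\<lambda>_. l) (place i (basis k) * place j (basis k')) =
      place l (basis k * basis k')"
    by (simp add: place_basis tens_map_def lin_ext_single mult_single)
qed (unfold tens_map_def, (rule linear_map_id linear_map_comp[OF linear_map_mult(1)]
  linear_map_comp[OF linear_map_mult(2)] linear_map_comp[OF linear_map_lin_ext]
  linear_map_comp[OF linear_map_place])+)

lemma tens_coprod_keys:
  fixes u :: "('i, 'r::comm_ring_1) tens"
  assumes "u \<in> tensor_power I" "(k, l) \<in> keys (tens_coprod u)"
  shows "keys k \<subseteq> I"
proof -
  have prod: "x \<in> {x. keys (fst x) \<subseteq> I}"
    if "x \<in> keys (\<Prod>i\<in>K. lin_ext (\<lambda>(p, q). basis (single i p, single i q)) (h i))" "K \<subseteq> I"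
    for x :: "'i tkey \<times> 'i tkey" and K and h :: "'i \<Rightarrow> (_ \<Rightarrow>\<^sub>0 'r)"
    using that
  proof (induction K arbitrary: x rule: infinite_finite_induct)
    case (insert i K)
    let ?a = "lin_ext (\<lambda>(p, q). basis (single i p, single i q)) (h i)"
    obtain y z where yz: "x = y + z" "y \<in> keys ?a"
      "z \<in> keys (\<Prod>i\<in>K. lin_ext (\<lambda>(p, q). basis (single i p, single i q)) (h i))"
      using insert.prems(1) insert.hyps keys_mult by fastforce
    have "keys (fst y) \<subseteq> {i}"
      using yz(2) keys_lin_ext by (fastforce split: if_splits)
    moreover have "keys (fst z) \<subseteq> I"
      using insert.IH[OF yz(3)] insert.prems by simp
    ultimately show ?case
      using insert.prems Poly_Mapping.keys_add[of "fst y" "fst z"] by (auto simp: yz(1))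
  qed auto
  obtain m where "m \<in> keys u" "(k, l) \<in> keys (\<Prod>i\<in>keys m.
      lin_ext (\<lambda>(p, q). basis (single i p, single i q)) (pi0_coprod (basis (lookup m i)) :: _ \<Rightarrow>\<^sub>0 'r))"
    using assms(2) keys_lin_ext unfolding tens_coprod_def by blast
  with prod[OF this(2)] show ?thesis
    using assms(1) by (auto simp: tensor_power_def)
qed


section \<open>The twisted vertex algebra $T_*(\pi_0)^r$\<close>

text \<open>
  \<open>r(\<Otimes>\<^sub>i a\<^sub>i \<otimes> \<Otimes>\<^sub>j d\<^sub>j)\<close> for monomials \<open>a\<^sub>i = lookup k i\<close> and \<open>d\<^sub>j = lookup l j\<close>. The tensors
  \<open>\<Otimes>\<^sub>i\<^sub>,\<^sub>j a\<^sub>i\<^sup>(\<^sup>j\<^sup>)\<close> and \<open>\<Otimes>\<^sub>i\<^sub>,\<^sub>j d\<^sub>j\<^sup>(\<^sup>i\<^sup>)\<close> have positions in \<open>I \<times> J\<close>. The order in which \<open>I\<close> and \<open>J\<close>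
  are listed is immaterial because \<open>\<pi>\<^sub>0\<close> is cocommutative.
\<close>

definition bichar_ext ::
    "('r::comm_ring_1 pi0 \<Rightarrow> 'r pi0 \<Rightarrow> 'r laurent) \<Rightarrow> nat set \<Rightarrow> nat set \<Rightarrow> nat tkey \<Rightarrow> nat tkey \<Rightarrow> 'r dloc"
  where "bichar_ext r I J k l =
    (let A = \<Prod>i\<in>I. iter_coprod (map (\<lambda>j. (i, j)) (sorted_list_of_set J)) (basis (lookup k i));
         B = \<Prod>j\<in>J. iter_coprod (map (\<lambda>i. (i, j)) (sorted_list_of_set I)) (basis (lookup l j))
     in \<Sum>p\<in>keys A. \<Sum>q\<in>keys B.
          dloc_const (lookup A p * lookup B q) *
          (\<Prod>i\<in>I. \<Prod>j\<in>J. laurent_subst i j (r (basis (lookup p (i, j))) (basis (lookup q (i, j))))))"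

text \<open>
  \<open>u \<odot> w = \<Sum> u'w' r(u'' \<otimes> w'')\<close>. The target \<open>\<pi>\<^sub>0\<^bsup>\<otimes>(I\<squnion>J)\<^esup> \<otimes> S\<^sub>0(I : J)\<close> is represented by the
  tensors with coefficients in \<open>S\<^sub>0(I : J)\<close> (see
  \<open>twisted_mult_tensor_power\<close> and \<open>twisted_mult_S0\<close>).
\<close>

definition twisted_mult ::
    "('r::comm_ring_1 pi0 \<Rightarrow> 'r pi0 \<Rightarrow> 'r laurent) \<Rightarrow> nat set \<Rightarrow> nat set \<Rightarrow>
      (nat, 'r) tens \<Rightarrow> (nat, 'r) tens \<Rightarrow> (nat, 'r dloc) tens"
  where "twisted_mult r I J u w =
    (\<Sum>(u', u'')\<in>keys (tens_coprod u). \<Sum>(w', w'')\<in>keys (tens_coprod w).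
      single (u' + w')
        (dloc_const (lookup (tens_coprod u) (u', u'') * lookup (tens_coprod w) (w', w'')) *
          bichar_ext r I J u'' w''))"

lemma twisted_mult_S0:
  assumes "I \<inter> J = {}"
  shows "lookup (twisted_mult r I J u w) k \<in> S0_colon I J"
  unfolding twisted_mult_def bichar_ext_def Let_def lookup_sum case_prod_unfold lookup_single when_def
  by (intro S0_sum) (simp split: if_split, intro conjI impI S0_zero S0_sum S0_mult S0_const S0_prod laurent_subst_S0 assms)

lemma twisted_mult_tensor_power:
  assumes "u \<in> tensor_power I" "w \<in> tensor_power J"
  shows "twisted_mult r I J u w \<in> tensor_power (I \<union> J)"
proof -
  have "keys m \<subseteq> I \<union> J" if m: "m \<in> keys (twisted_mult r I J u w)" for m
  proof -
    obtain x y where "x \<in> keys (tens_coprod u)" "y \<in> keys (tens_coprod w)" "m = fst x + fst y"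
      using m unfolding twisted_mult_def case_prod_unfold
      by (auto dest!: subsetD[OF keys_sum] split: if_splits)
    then show ?thesis
      using tens_coprod_keys[OF assms(1), of "fst x" "snd x"]
        tens_coprod_keys[OF assms(2), of "fst y" "snd y"]
        Poly_Mapping.keys_add[of "fst x" "fst y"] by auto
  qed
  then show ?thesis
    by (auto simp: tensor_power_def)
qed

text \<open>
  The structure of an \<open>(R-Mod, H\<^sub>a, S\<^sub>0)\<close>-vertex algebra with \<open>V(I)\<close> inside the tensors: the objects
  \<open>V(I)\<close>, the maps \<open>V(f)\<close>, the action of \<open>D\<^sup>(\<^sup>n\<^sup>)\<close> at each position \<open>i\<close>, and the singular
  multiplications \<open>V(I) \<otimes> V(J) \<rightarrow> V(I \<squnion> J) \<otimes> S\<^sub>0(I : J)\<close> for disjoint \<open>I\<close>, \<open>J\<close>.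
\<close>

record (overloaded) 'r hs_vertex_algebra =
  hs_obj :: "nat set \<Rightarrow> (nat, 'r) tens set"
  hs_map :: "(nat \<Rightarrow> nat) \<Rightarrow> (nat, 'r) tens \<Rightarrow> (nat, 'r) tens"
  hs_act :: "nat \<Rightarrow> nat \<Rightarrow> (nat, 'r) tens \<Rightarrow> (nat, 'r) tens"
  hs_mult :: "nat set \<Rightarrow> nat set \<Rightarrow> (nat, 'r) tens \<Rightarrow> (nat, 'r) tens \<Rightarrow> (nat, 'r dloc) tens"

definition twisted_algebra ::
    "('r::comm_ring_1 pi0 \<Rightarrow> 'r pi0 \<Rightarrow> 'r laurent) \<Rightarrow> 'r hs_vertex_algebra"
  where "twisted_algebra r =
    \<lparr>hs_obj = tensor_power, hs_map = tens_map, hs_act = tens_hasse, hs_mult = twisted_mult r\<rparr>"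


section \<open>Ordinary vertex algebras\<close>

text \<open>
  The data of a vertex algebra with space \<open>'m\<close>: the vacuum, the translation operator and the
  state-field correspondence, \<open>va_field W u w\<close> being \<open>Y(u, z)w\<close>.
\<close>

record (overloaded) 'm vertex_data =
  va_vac :: "'m::zero"
  va_transl :: "'m \<Rightarrow> 'm"
  va_field :: "'m \<Rightarrow> 'm \<Rightarrow> 'm fls"

text \<open>
  The expansion \<open>p \<otimes> q \<mapsto> \<Sum> (D\<^sup>(\<^sup>i\<^sup>)p)(D\<^sup>(\<^sup>j\<^sup>)q) x\<^sub>1\<^sup>i x\<^sub>2\<^sup>j\<close> on \<open>V({1, 2})\<close> (see \<open>taylor_tensor\<close>). The
  product is \<open>V\<close> applied to \<open>{1, 2} \<rightarrow> {1}\<close>; the outer series variable is \<open>x\<^sub>2\<close>, the inner one \<open>x\<^sub>1\<close>.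
\<close>

definition taylor :: "'r::comm_ring_1 hs_vertex_algebra \<Rightarrow> (nat, 'r) tens \<Rightarrow> 'r pi0 fps fps"
  where "taylor V t =
    Abs_fps (\<lambda>j. Abs_fps (\<lambda>i. unplace 1 (hs_map V (\<lambda>_. 1) (hs_act V 1 i (hs_act V 2 j t)))))"

lemma taylor_tensor:
  "fps_nth (fps_nth (taylor (twisted_algebra r) (place 1 p * place 2 q)) j) i =
    hasse i p * hasse j q"
  using tens_hasse_place[of "2::nat" 1 j q p] tens_hasse_place[of "1::nat" 2 i p "hasse j q"]
  by (simp add: taylor_def twisted_algebra_def tens_map_place unplace_place mult.commute)

text \<open>The element of \<open>S\<^sub>0({1} : {2}) = R[(x\<^sub>1 - x\<^sub>2)\<^sup>\<plusminus>\<^sup>1]\<close> at \<open>x\<^sub>2 = 0\<close>.\<close>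

definition coeff_at_0 :: "'r::comm_ring_1 dloc \<Rightarrow> 'r pi0 fls"
  where "coeff_at_0 f =
    (let g = inv (laurent_subst 1 2) f
     in \<Sum>n\<in>keys g. fls_const (single 0 (lookup g n)) * fls_X_intpow n)"

definition associated_va :: "'r::comm_ring_1 hs_vertex_algebra \<Rightarrow> 'r pi0 vertex_data"
  where "associated_va V =
    \<lparr>va_vac = 1,
     va_transl = (\<lambda>u. unplace 1 (hs_act V 1 1 (place 1 u))),
     va_field = (\<lambda>u w.
       let s = hs_mult V {1} {2} (place 1 u) (place 2 w)
       in \<Sum>k\<in>keys s. fps_to_fls (fps_nth (taylor V (basis k)) 0) * coeff_at_0 (lookup s k))\<rparr>"


section \<open>The Heisenberg vertex algebra\<close>

text \<open>
  Elements of \<open>End(\<pi>\<^sub>0)[[z, z\<^sup>-\<^sup>1]]\<close>; \<open>a n\<close> is the coefficient of \<open>z\<^sup>n\<close>, i.e. the mode usually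
  written \<open>a\<^bsub>(-n-1)\<^esub>\<close>.
\<close>

type_synonym 'm distribution = "int \<Rightarrow> 'm \<Rightarrow> 'm"

definition dist_deriv :: "nat \<Rightarrow> 'm::comm_ring_1 distribution \<Rightarrow> 'm distribution"
  where "dist_deriv k a = (\<lambda>n w. of_int (int_binomial (n + int k) k) * a (n + int k) w)"

text \<open>
  \<open>:a(z)b(z): = a(z)\<^sub>+b(z) + b(z)a(z)\<^sub>-\<close>, where \<open>a(z)\<^sub>+\<close> collects the nonnegative powers of \<open>z\<close>.
  Both sums have finitely many nonzero terms when \<open>a\<close> and \<open>b\<close> are fields.
\<close>

definition normal_product :: "'m::comm_ring_1 distribution \<Rightarrow> 'm distribution \<Rightarrow> 'm distribution"
  where "normal_product a b = (\<lambda>n w.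
    Sum_any (\<lambda>k. a k (b (n - k) w) when k \<ge> 0) + Sum_any (\<lambda>k. b (n - k) (a k w) when k < 0))"

definition identity_field :: "'m::comm_ring_1 distribution"
  where "identity_field n w = (if n = 0 then w else 0)"

definition normal_products :: "'m::comm_ring_1 distribution list \<Rightarrow> 'm distribution"
  where "normal_products as = foldr normal_product as identity_field"

definition heisenberg_modes :: "'r::comm_ring_1 \<Rightarrow> (int \<Rightarrow> 'r pi0 \<Rightarrow> 'r pi0) \<Rightarrow> bool"
  where "heisenberg_modes c b \<longleftrightarrow>
    (\<forall>n. linear_map (b n)) \<and>
    (\<forall>m n w. b m (b n w) - b n (b m w) = smul (if m + n = 0 then c * of_int m else 0) w) \<and>
    (\<forall>n\<ge>0. b n 1 = 0) \<and>
    (\<forall>n\<ge>1. \<forall>w. b (- int n) w = bneg n * w)"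

text \<open>
  In the last clause, \<open>\<lambda>l. b (- l - 1)\<close> is the distribution \<open>b(z) = \<Sum>\<^sub>n b\<^sub>n z\<^bsup>-n-1\<^esup>\<close>; the empty list gives
  \<open>Y(v\<^sub>0, z) = id\<close> and the list \<open>[1]\<close> gives \<open>Y(b\<^sub>-\<^sub>1v\<^sub>0, z) = b(z)\<close>.
\<close>

definition is_heisenberg_va :: "'r::comm_ring_1 \<Rightarrow> 'r pi0 vertex_data \<Rightarrow> bool"
  where "is_heisenberg_va c W \<longleftrightarrow> (\<exists>b.
    heisenberg_modes c b \<and>
    va_vac W = 1 \<and>
    linear_map (va_transl W) \<and>
    va_transl W 1 = 0 \<and>
    (\<forall>n w. va_transl W (b n w) - b n (va_transl W w) = - (of_int n * b (n - 1) w)) \<and>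
    (\<forall>w n. linear_map (\<lambda>u. fls_nth (va_field W u w) n)) \<and>
    (\<forall>ns. (\<forall>n\<in>set ns. n \<ge> 1) \<longrightarrow>
      (\<forall>w n. fls_nth (va_field W (\<Prod>i\<leftarrow>ns. bneg i) w) n =
        normal_products (map (\<lambda>i. dist_deriv (i - 1) (\<lambda>l. b (- l - 1))) ns) n w)))"

end

theory Submission
  imports Defs
begin

text \<open>
  Everything is reduced to the combinatorics of monomials. As \<open>\<pi>\<^sub>0\<close> is a polynomial ring in primitive
  generators, the coproduct of a monomial is the sum over all ways of distributing its factors over two
  places (\<open>sweedler\<close>, \<open>pi0_coprod_basis\<close>), and identities between such sums are inductions on the
  monomial.

  The bicharacter. A bicharacter is an algebra homomorphism from \<open>\<pi>\<^sub>0\<close> to the convolution algebra of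
  linear forms on \<open>\<pi>\<^sub>0\<close> that sends the primitive generators to derivations over the counit. Therefore it is determined
  by its values on pairs of generators (\<open>bicharacter_basis\<close>), and every matrix of values occurs
  (\<open>bicharacter_bichar_of\<close>). Invariance forces the value on \<open>b\<^bsub>-(k+1)\<^esub>v\<^sub>0 \<otimes> b\<^bsub>-(l+1)\<^esub>v\<^sub>0\<close> to be the
  divided-power derivative of order \<open>(k, l)\<close> of \<open>c (x\<^sub>1 - x\<^sub>2)\<^sup>-\<^sup>2\<close>. Conversely these values give an
  invariant bicharacter, because the \<open>D\<^sup>(\<^sup>i\<^sup>)\<close> and the divided-power derivatives obey the same Leibniz
  rule (\<open>bicharacter_hasse\<close>).

  The Heisenberg vertex algebra. The commutation relations together with \<open>b\<^sub>nv\<^sub>0 = 0\<close> for \<open>n \<ge> 0\<close> and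
  \<open>T v\<^sub>0 = 0\<close> determine the modes and the translation operator, since the vacuum generates \<open>\<pi>\<^sub>0\<close> under
  the creation operators: \<open>b\<^sub>n\<close> is \<open>c n \<partial>/\<partial>b\<^bsub>-n\<^esub>\<close> for \<open>n > 0\<close>, \<open>b\<^sub>0 = 0\<close>, and \<open>T = D\<^sup>(\<^sup>1\<^sup>)\<close>
  (\<open>heisenberg_modes_unique\<close>, \<open>translation_unique\<close>). The fields of monomials are then prescribed, so
  there is at most one such vertex algebra.

  The comparison. In the product \<open>\<Sum> (bu)'w' r((bu)'' \<otimes> w'')\<close> with a generator \<open>b\<close>, the factor \<open>b\<close> goes
  to the first or to the second place. In the first place it contributes its Taylor expansion
  \<open>\<Sum>\<^sub>i D\<^sup>(\<^sup>i\<^sup>)b x\<^sup>i\<close>, the generating series of the creation operators in its field. In the second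
  place it is paired with one generator of \<open>w\<close> and removes it, which is a combination of the derivations
  \<open>\<partial>/\<partial>b\<^bsub>-(l+1)\<^esub>\<close>; the values of \<open>r\<close> at \<open>x\<^sub>2 = 0\<close> are exactly the coefficients with which the
  annihilation operators enter the field of \<open>b\<close>. Hence \<open>Y(bu, z) = b(z)\<^sub>+Y(u, z) + Y(u, z)b(z)\<^sub>-\<close>, the
  recursion for normally ordered products (\<open>monomial_field_basis_add_mset\<close>,
  \<open>fls_nth_monomial_field_add_mset\<close>). So the fields obtained by twisting are those of a Heisenberg
  vertex algebra. This also proves that a Heisenberg vertex algebra exists.
\<close>

section \<open>Linear and semilinear maps between free modules\<close>

lemma smul_zero: "smul a 0 = 0"
  by (simp add: smul_def)

lemma smul_single: "smul a (single k b) = single k (a * b)"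
  by (simp add: smul_def mult_single)

lemma smul_smul: "smul a (smul b x) = smul (a * b) x"
  by (simp add: smul_def mult_single flip: mult.assoc)

lemma smul_of_nat: "smul (of_nat n) u = of_nat n * u"
  and smul_of_int: "smul (of_int i) u = of_int i * u"
  by (simp_all add: smul_def)

lemma linear_map_smul: "linear_map f \<Longrightarrow> linear_map (\<lambda>x. smul a (f x))"
  unfolding smul_def[of a] by (rule linear_map_comp[OF linear_map_mult(1)])

lemma linear_map_scale: "linear_map f \<Longrightarrow> f (smul a x) = smul a (f x)"
  by (simp add: module_hom_iff)

lemma linear_map_sum: "(\<And>i. i \<in> I \<Longrightarrow> linear_map (f i)) \<Longrightarrow> linear_map (\<lambda>x. \<Sum>i\<in>I. f i x)"
  by (induction I rule: infinite_finite_induct)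
    (auto simp: module_hom_iff module_smul smul_def algebra_simps)

lemma linear_map_add: "linear_map f \<Longrightarrow> linear_map g \<Longrightarrow> linear_map (\<lambda>x. f x + g x)"
  and linear_map_diff: "linear_map f \<Longrightarrow> linear_map g \<Longrightarrow> linear_map (\<lambda>x. f x - g x)"
  and linear_map_zero: "linear_map (\<lambda>_. 0)"
  by (auto simp: module_hom_iff module_smul smul_def algebra_simps)

lemma linear_map_lin_ext_fun:
  assumes "\<And>k. linear_map (\<lambda>x. f x k)"
  shows "linear_map (\<lambda>x. lin_ext (f x) p)"
  unfolding lin_ext_def by (intro linear_map_sum linear_map_smul assms)

text \<open>
  The extension of \<open>F\<close> that is linear along a change of scalars \<open>\<iota>\<close>. It serves to describe, over \<open>R\<close>,
  maps into rings that contain \<open>R\<close> through \<open>\<iota>\<close>, such as \<open>\<pi>\<^sub>0((x))\<close> or tensors with coefficients in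
  \<open>S\<^sub>0\<close>; with \<open>\<iota> = single 0\<close> it is \<^const>\<open>lin_ext\<close>. Semilinear maps for different \<open>\<iota>\<close> are compared as
  additive maps, on multiples of basis elements (\<open>additive_eqI\<close>).
\<close>
definition semilin :: "('r \<Rightarrow> 'a) \<Rightarrow> ('k \<Rightarrow> 'a) \<Rightarrow> ('k \<Rightarrow>\<^sub>0 'r::comm_ring_1) \<Rightarrow> 'a::comm_ring_1"
  where "semilin \<iota> F p = (\<Sum>k\<in>keys p. \<iota> (lookup p k) * F k)"

lemma lin_ext_eq_semilin: "lin_ext f = semilin (single 0) f"
  by (simp add: fun_eq_iff lin_ext_def semilin_def smul_def)

lemma semilin_superset:
  assumes "additive \<iota>" "finite K" "keys p \<subseteq> K"
  shows "semilin \<iota> F p = (\<Sum>k\<in>K. \<iota> (lookup p k) * F k)"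
  unfolding semilin_def
  by (rule sum.mono_neutral_left)
    (use assms in \<open>auto simp: in_keys_iff additive.zero\<close>)

lemma semilin_single:
  assumes "additive \<iota>"
  shows "semilin \<iota> F (single k a) = \<iota> a * F k"
  using semilin_superset[OF assms, of "{k}" "single k a" F] by (auto split: if_splits)

lemma additive_semilin:
  assumes "additive \<iota>"
  shows "additive (semilin \<iota> F)"
proof
  fix p q :: "'c \<Rightarrow>\<^sub>0 'a"
  let ?K = "keys p \<union> keys q"
  have "semilin \<iota> F f = (\<Sum>k\<in>?K. \<iota> (lookup f k) * F k)" if "f \<in> {p, q, p + q}" for f
    using that assms Poly_Mapping.keys_add[of p q] by (intro semilin_superset) auto
  then show "semilin \<iota> F (p + q) = semilin \<iota> F p + semilin \<iota> F q"
    by (simp add: lookup_add additive.add[OF assms] distrib_right sum.distrib)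
qed

lemma poly_mapping_expand: "p = (\<Sum>k\<in>keys p. single k (lookup p k))"
  by (rule poly_mapping_eqI)
    (auto simp: lookup_sum lookup_single when_def in_keys_iff)

lemma additive_eqI:
  fixes f g :: "('k \<Rightarrow>\<^sub>0 'r::comm_ring_1) \<Rightarrow> 'b::ab_group_add"
  assumes f: "additive f" and g: "additive g"
    and eq: "\<And>k a. f (single k a) = g (single k a)"
  shows "f p = g p"
proof -
  have "f p = (\<Sum>k\<in>keys p. f (single k (lookup p k)))"
    by (subst poly_mapping_expand[of p]) (rule additive.sum[OF f])
  also have "\<dots> = g p"
    by (subst (2) poly_mapping_expand[of p]) (simp add: eq additive.sum[OF g])
  finally show ?thesis .
qed

lemma additive_comp: "additive f \<Longrightarrow> additive g \<Longrightarrow> additive (\<lambda>x. f (g x))"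
  by (simp add: additive_def)

lemma additive_mult_const:
  fixes a :: "'b::comm_ring_1"
  shows "additive (\<lambda>x. a * x)" "additive (\<lambda>x. x * a)"
  by (simp_all add: additive_def algebra_simps)

lemma linear_map_additive: "linear_map f \<Longrightarrow> additive f"
  by (simp add: additive_def module_hom_iff)

lemma semilin_mult:
  fixes p q :: "'k::comm_monoid_add \<Rightarrow>\<^sub>0 'r::comm_ring_1"
  assumes \<iota>: "additive \<iota>" "\<And>a b. \<iota> (a * b) = \<iota> a * \<iota> b"
    and F: "\<And>k l. F (k + l) = F k * F l"
  shows "semilin \<iota> F (p * q) = semilin \<iota> F p * semilin \<iota> F q"
proof (rule additive_eqI[where f = "\<lambda>p. semilin \<iota> F (p * q)"
      and g = "\<lambda>p. semilin \<iota> F p * semilin \<iota> F q"])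
  fix k a
  show "semilin \<iota> F (single k a * q) = semilin \<iota> F (single k a) * semilin \<iota> F q"
  proof (rule additive_eqI[where f = "\<lambda>q. semilin \<iota> F (single k a * q)"
      and g = "\<lambda>q. semilin \<iota> F (single k a) * semilin \<iota> F q"])
    fix l b
    show "semilin \<iota> F (single k a * single l b) =
        semilin \<iota> F (single k a) * semilin \<iota> F (single l b)"
      by (simp add: mult_single semilin_single[OF \<iota>(1)] \<iota>(2) F mult_ac)
  qed (intro additive_comp[OF additive_semilin[OF \<iota>(1)]] additive_mult_const
      additive_comp[OF additive_mult_const(1)] additive_semilin[OF \<iota>(1)])+
qed (intro additive_comp[OF additive_semilin[OF \<iota>(1)]] additive_mult_const
      additive_comp[OF additive_mult_const(2)] additive_semilin[OF \<iota>(1)])+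

lemma additive_single: "additive (single k)"
  by (simp add: additive_def single_add)

lemma semilin_smul:
  fixes p :: "'k::comm_monoid_add \<Rightarrow>\<^sub>0 'r::comm_ring_1"
  assumes "additive \<iota>" "\<And>a b. \<iota> (a * b) = \<iota> a * \<iota> b"
  shows "semilin \<iota> F (smul a p) = \<iota> a * semilin \<iota> F p"
proof (rule additive_eqI[where f = "\<lambda>p. semilin \<iota> F (smul a p)"])
  show "additive (\<lambda>p. semilin \<iota> F (smul a p))"
    unfolding smul_def by (intro additive_comp[OF additive_semilin] additive_mult_const assms)
  show "additive (\<lambda>p. \<iota> a * semilin \<iota> F p)"
    by (intro additive_comp[OF additive_mult_const(1)] additive_semilin assms)
qed (simp add: smul_single semilin_single assms mult_ac)

section \<open>Coproducts of monomials\<close>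

text \<open>
  The generators of \<open>\<pi>\<^sub>0\<close> are primitive and its coproduct is multiplicative, so the coproduct of a
  monomial \<open>m\<close> is the sum of \<open>p \<otimes> q\<close> over all ways of handing each factor of \<open>m\<close> either to \<open>p\<close> or to
  \<open>q\<close>. \<open>sweedler m F\<close> is the sum of \<open>F p q\<close> over these ways, with values in any commutative monoid.
  The fold processes the factors one at a time. Thus every identity between iterated Sweedler sums is
  an induction on \<open>m\<close> with \<open>F\<close> arbitrary.
\<close>
definition sweedler ::
    "'x multiset \<Rightarrow> ('x multiset \<Rightarrow> 'x multiset \<Rightarrow> 'b::comm_monoid_add) \<Rightarrow> 'b"
  where "sweedler = fold_mset
    (\<lambda>k S F. S (\<lambda>p q. F (add_mset k p) q + F p (add_mset k q))) (\<lambda>F. F {#} {#})"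

lemma sweedler_empty [simp]: "sweedler {#} F = F {#} {#}"
  by (simp add: sweedler_def)

lemma sweedler_add_mset:
  fixes F :: "'x multiset \<Rightarrow> 'x multiset \<Rightarrow> 'b::comm_monoid_add"
  shows "sweedler (add_mset k m) F = sweedler m (\<lambda>p q. F (add_mset k p) q + F p (add_mset k q))"
proof -
  interpret comp_fun_commute
    "\<lambda>k (S :: ('x multiset \<Rightarrow> 'x multiset \<Rightarrow> 'b) \<Rightarrow> 'b) F.
      S (\<lambda>p q. F (add_mset k p) q + F p (add_mset k q))"
    by standard (auto simp: fun_eq_iff add_mset_commute algebra_simps)
  show ?thesis
    by (simp add: sweedler_def)
qed

lemma sweedler_add: "sweedler m (\<lambda>p q. F p q + G p q) = sweedler m F + sweedler m G"
proof (induction m arbitrary: F G)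
  case (add k m)
  have "sweedler (add_mset k m) (\<lambda>p q. F p q + G p q) =
      sweedler m (\<lambda>p q. (F (add_mset k p) q + F p (add_mset k q)) +
        (G (add_mset k p) q + G p (add_mset k q)))"
    by (simp add: sweedler_add_mset algebra_simps)
  then show ?case
    by (simp add: add.IH sweedler_add_mset)
qed simp

lemma sweedler_additive:
  assumes "additive h"
  shows "h (sweedler m F) = sweedler m (\<lambda>p q. h (F p q))"
  by (induction m arbitrary: F) (simp_all add: sweedler_add_mset additive.add[OF assms])

lemma sweedler_mult:
  fixes a :: "'b::comm_ring_1"
  shows "a * sweedler m F = sweedler m (\<lambda>p q. a * F p q)"
    and "sweedler m F * a = sweedler m (\<lambda>p q. F p q * a)"
  by (rule sweedler_additive[where h = "\<lambda>x. a * x"] sweedler_additive[where h = "\<lambda>x. x * a"],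
    rule additive_mult_const)+

lemma sweedler_product:
  fixes F :: "'x multiset \<Rightarrow> 'x multiset \<Rightarrow> 'a::comm_ring_1"
  shows "sweedler m F * sweedler n G = sweedler m (\<lambda>p q. sweedler n (\<lambda>s t. F p q * G s t))"
  by (simp add: sweedler_mult(2)) (simp add: sweedler_mult(1))

lemma sweedler_sum:
  "(\<Sum>i\<in>I. sweedler m (F i)) = sweedler m (\<lambda>p q. \<Sum>i\<in>I. F i p q)"
proof (induction m arbitrary: F)
  case (add k m)
  then show ?case
    by (simp add: sweedler_add_mset sum.distrib)
qed simp

lemma sweedler_swap:
  "sweedler m (\<lambda>p q. sweedler n (F p q)) = sweedler n (\<lambda>s t. sweedler m (\<lambda>p q. F p q s t))"
  by (induction m arbitrary: F) (simp_all add: sweedler_add_mset flip: sweedler_add)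

lemma sweedler_cocommute: "sweedler m F = sweedler m (\<lambda>p q. F q p)"
  by (induction m arbitrary: F) (simp_all add: sweedler_add_mset add.commute)

lemma sweedler_coassoc:
  "sweedler m (\<lambda>p q. sweedler p (\<lambda>s t. F s t q)) = sweedler m (\<lambda>s q. sweedler q (\<lambda>t u. F s t u))"
proof (induction m arbitrary: F)
  case (add k m)
  show ?case
    using add[of "\<lambda>s t u. F (add_mset k s) t u + F s (add_mset k t) u + F s t (add_mset k u)"]
    by (simp add: sweedler_add_mset sweedler_add add_ac)
qed simp

text \<open>
  Coassociativity together with cocommutativity: three places can be permuted freely; here the last
  two of them are exchanged.
\<close>
lemma sweedler_coassoc_commute:
  "sweedler m (\<lambda>p q. sweedler p (\<lambda>s t. F s t q)) = sweedler m (\<lambda>p q. sweedler p (\<lambda>s t. F s q t))"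
proof -
  have "sweedler m (\<lambda>p q. sweedler p (\<lambda>s t. F s t q)) = sweedler m (\<lambda>s q. sweedler q (\<lambda>t u. F s t u))"
    by (rule sweedler_coassoc)
  also have "\<dots> = sweedler m (\<lambda>s q. sweedler q (\<lambda>t u. F s u t))"
    by (subst sweedler_cocommute) (rule refl)
  also have "\<dots> = sweedler m (\<lambda>p q. sweedler p (\<lambda>s t. F s q t))"
    by (rule sweedler_coassoc[symmetric])
  finally show ?thesis .
qed

lemma sweedler_union:
  "sweedler (m + n) F = sweedler m (\<lambda>p q. sweedler n (\<lambda>s t. F (p + s) (q + t)))"
  by (induction m arbitrary: F) (simp_all add: sweedler_add_mset sweedler_add)

lemma sweedler_counit:
  "sweedler m (\<lambda>p q. if p = {#} then F q else 0) = F m"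
  by (induction m arbitrary: F) (simp_all add: sweedler_add_mset)

lemma basis_add_mset: "basis (add_mset k m) = basis {#k#} * basis m"
  by (simp add: mult_single)

lemma hasse_generator:
  "hasse i (basis {#k#}) = smul (of_nat ((k + i) choose i)) (basis {#k + i#})"
  using hasse_bneg[of "Suc k" i] by (simp add: bneg_def smul_def)

text \<open>
  The induction principle used for operators on \<open>\<pi>\<^sub>0\<close>: the vacuum generates \<open>\<pi>\<^sub>0\<close> under
  multiplication by the creation operators.
\<close>
lemma linear_map_pi0_eqI:
  assumes f: "linear_map f" and g: "linear_map g" and one: "f 1 = g 1"
    and step: "\<And>k w. f w = g w \<Longrightarrow> f (basis {#k#} * w) = g (basis {#k#} * w)"
  shows "f u = g u"
proof (rule linear_map_eqI[OF f g])
  show "f (basis m) = g (basis m)" for m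
  proof (induction m)
    case empty
    show ?case
      using one by simp
  next
    case (add k m)
    show ?case
      unfolding basis_add_mset[of k m] by (rule step) (rule add.IH)
  qed
qed

lemma pi0_coprod_basis:
  "pi0_coprod (basis m :: 'r::comm_ring_1 pi0) = sweedler m (\<lambda>p q. basis (p, q))"
proof (induction m)
  case (add k m)
  have "pi0_coprod (basis (add_mset k m) :: 'r pi0) = pi0_coprod (bneg (Suc k)) * pi0_coprod (basis m)"
    by (subst basis_add_mset) (simp add: pi0_coprod_mult bneg_def)
  also have "\<dots> = sweedler (add_mset k m) (\<lambda>p q. basis (p, q))"
    by (simp add: pi0_coprod_bneg add.IH sweedler_mult(1) mult_single distrib_right sweedler_add_mset)
  finally show ?case .
qed (simp add: pi0_coprod_def mpoly_eval_single mult_single flip: single_one zero_prod_def)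

text \<open>
  The bridge to the bialgebra \<open>\<pi>\<^sub>0\<close>: whatever ring the values lie in, Sweedler notation for the
  coproduct of a monomial is a Sweedler sum.
\<close>
lemma semilin_pi0_coprod:
  assumes "additive \<iota>" "\<iota> 1 = 1"
  shows "semilin \<iota> (\<lambda>(p, q). F p q) (pi0_coprod (basis m)) = sweedler m F"
  by (simp add: pi0_coprod_basis sweedler_additive[OF additive_semilin[OF assms(1)]]
      semilin_single[OF assms(1)] assms(2))

lemma lin_ext_pi0_coprod:
  "lin_ext (\<lambda>(p, q). F p q) (pi0_coprod (basis m)) = sweedler m F"
  by (simp add: lin_ext_eq_semilin semilin_pi0_coprod additive_single)

section \<open>Divided-power derivatives\<close>

lemma of_int_int_binomial: "of_int (int_binomial n k) = (of_int n :: rat) gchoose k"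
  using of_int_gbinomial[of n k, where 'a = rat]
  by (simp only: gbinomial_prod_rev int_binomial_def)

text \<open>
  Identities for the integral binomial coefficient are inherited from the generalised binomial
  coefficient over the rationals, where they are polynomial identities.
\<close>
lemma int_binomial_Vandermonde:
  "(\<Sum>j\<le>i. int_binomial n j * int_binomial m (i - j)) = int_binomial (n + m) i"
proof -
  have "of_int (\<Sum>j\<le>i. int_binomial n j * int_binomial m (i - j)) =
      (of_int (int_binomial (n + m) i) :: rat)"
    using gbinomial_Vandermonde[of "of_int n :: rat" "of_int m" i]
    by (simp add: of_int_int_binomial atLeast0AtMost)
  then show ?thesis
    by (simp only: of_int_eq_iff)
qed

text \<open>
  This makes the divided powers \<open>\<partial>\<^sup>i/i!\<close> multiply like the basis of \<open>H\<^sub>a\<close>.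
\<close>
lemma int_binomial_trinomial_revision:
  "int_binomial n j * int_binomial (n - int j) i =
    of_nat ((i + j) choose i) * int_binomial n (i + j)"
proof -
  have "of_nat (i + j) gchoose j = (of_nat ((i + j) choose i) :: rat)"
    using binomial_symmetric[of j "i + j"] by (simp del: of_nat_add flip: binomial_gbinomial)
  then have "of_int (int_binomial n j * int_binomial (n - int j) i) =
      (of_int (of_nat ((i + j) choose i) * int_binomial n (i + j)) :: rat)"
    using gbinomial_trinomial_revision[of j "i + j" "of_int n :: rat"]
    by (simp add: of_int_int_binomial mult.commute)
  then show ?thesis
    by (simp only: of_int_eq_iff)
qed

lemma int_binomial_0 [simp]: "int_binomial n 0 = 1"
  by (simp add: int_binomial_def)

lemma int_binomial_0_left [simp]: "int_binomial 0 i = (if i = 0 then 1 else 0)"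
proof (cases "i = 0")
  case False
  then have *: "(\<Prod>j = 0..<i. - int j) = 0"
    by (intro prod_zero) auto
  show ?thesis
    by (simp add: int_binomial_def False *)
qed simp

lemma linear_map_ddx1: "linear_map (ddx1 i)"
  unfolding ddx1_def by (rule linear_map_lin_ext)

lemma linear_map_ddx2: "linear_map (ddx2 i)"
  unfolding ddx2_def by (rule linear_map_lin_ext)

lemma ddx1_single: "ddx1 i (single n a) = single (n - int i) (a * of_int (int_binomial n i))"
  by (simp add: ddx1_def lin_ext_single smul_single)

lemma ddx2_single:
  "ddx2 i (single n a) = single (n - int i) (a * ((- 1) ^ i * of_int (int_binomial n i)))"
  by (simp add: ddx2_def lin_ext_single smul_single)

text \<open>
  On functions of \<open>x\<^sub>1 - x\<^sub>2\<close> the two derivations differ by a sign. So facts about the second variable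
  follow from the first.
\<close>
lemma ddx2_eq_ddx1: "ddx2 j f = smul ((- 1) ^ j) (ddx1 j f)"
proof (rule linear_map_eqI[where f = "ddx2 j" and g = "\<lambda>f. smul ((- 1) ^ j) (ddx1 j f)"])
  show "linear_map (\<lambda>f. smul ((- 1) ^ j) (ddx1 j f))"
    by (intro linear_map_smul linear_map_ddx1)
qed (simp_all add: linear_map_ddx2 ddx1_single ddx2_single smul_single)

lemmas linear_map_intros = linear_map_id linear_map_lin_ext linear_map_sum
  linear_map_comp[OF linear_map_mult(1)] linear_map_comp[OF linear_map_mult(2)]
  linear_map_ddx1 linear_map_comp[OF linear_map_ddx1]
  linear_map_ddx2 linear_map_comp[OF linear_map_ddx2]
  hasse_linear linear_map_comp[OF hasse_linear]

text \<open>
  The Leibniz rule for \<open>\<partial>\<^sup>i/i!\<close> on \<open>(x\<^sub>1 - x\<^sub>2)\<^sup>n (x\<^sub>1 - x\<^sub>2)\<^sup>m\<close> is Vandermonde's identity.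
\<close>
lemma ddx1_mult: "ddx1 i (f * g) = (\<Sum>j\<le>i. ddx1 j f * ddx1 (i - j) g)"
proof (rule bilinear_eqI[where F = "\<lambda>f g. ddx1 i (f * g)"
      and G = "\<lambda>f g. \<Sum>j\<le>i. ddx1 j f * ddx1 (i - j) g"])
  fix n m
  have "(\<Sum>j\<le>i. ddx1 j (basis n) * ddx1 (i - j) (basis m)) =
      (\<Sum>j\<le>i. single (n + m - int i) (of_int (int_binomial n j * int_binomial m (i - j))))"
    by (rule sum.cong)
      (auto simp: ddx1_single mult_single of_nat_diff intro!: arg_cong2[where f = single])
  also have "\<dots> = single (n + m - int i) (of_int (int_binomial (n + m) i))"
    by (simp add: additive.sum[OF additive_single, symmetric] flip: int_binomial_Vandermonde)
  also have "\<dots> = ddx1 i (basis n * basis m)"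
    by (simp add: mult_single ddx1_single)
  finally show "ddx1 i (basis n * basis m) = (\<Sum>j\<le>i. ddx1 j (basis n) * ddx1 (i - j) (basis m))"
    by (rule sym)
qed (intro linear_map_intros)+

lemma ddx2_mult: "ddx2 i (f * g) = (\<Sum>j\<le>i. ddx2 j f * ddx2 (i - j) g)"
proof -
  have "smul ((- 1) ^ i) (ddx1 j f * ddx1 (i - j) g) = ddx2 j f * ddx2 (i - j) g" if "j \<le> i" for j
  proof -
    have "(- 1) ^ i = (- 1) ^ j * (- 1 :: 'a) ^ (i - j)"
      using that by (simp flip: power_add)
    then have "single 0 ((- 1) ^ i) = single 0 ((- 1) ^ j) * (single 0 ((- 1) ^ (i - j)) :: 'a laurent)"
      by (simp add: mult_single)
    then show ?thesis
      by (simp add: ddx2_eq_ddx1 smul_def mult_ac)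
  qed
  then show ?thesis
    by (simp add: ddx2_eq_ddx1 ddx1_mult smul_def sum_distrib_left)
qed

lemma ddx1_ddx1: "ddx1 i (ddx1 j f) = smul (of_nat ((i + j) choose i)) (ddx1 (i + j) f)"
proof (rule linear_map_eqI[where f = "\<lambda>f. ddx1 i (ddx1 j f)"
      and g = "\<lambda>f. smul (of_nat ((i + j) choose i)) (ddx1 (i + j) f)"])
  show "linear_map (\<lambda>f. smul (of_nat ((i + j) choose i)) (ddx1 (i + j) f))"
    by (intro linear_map_smul linear_map_intros)
  fix n
  have "ddx1 i (ddx1 j (basis n)) =
      single (n - int j - int i) (of_int (int_binomial n j * int_binomial (n - int j) i))"
    by (simp add: ddx1_single)
  then show "ddx1 i (ddx1 j (basis n)) = smul (of_nat ((i + j) choose i)) (ddx1 (i + j) (basis n))"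
    unfolding int_binomial_trinomial_revision by (simp add: ddx1_single smul_single algebra_simps)
qed (intro linear_map_intros)

lemma ddx1_ddx2_commute: "ddx1 i (ddx2 j f) = ddx2 j (ddx1 i f)"
  using binomial_symmetric[of i "i + j"]
  by (simp add: ddx2_eq_ddx1 linear_map_scale[OF linear_map_ddx1] ddx1_ddx1 add.commute)

lemma ddx2_ddx2: "ddx2 i (ddx2 j f) = smul (of_nat ((i + j) choose i)) (ddx2 (i + j) f)"
  by (simp add: ddx2_eq_ddx1 linear_map_scale[OF linear_map_ddx1] ddx1_ddx1 smul_smul power_add
      mult_ac)

section \<open>Bicharacters on monomials\<close>

text \<open>
  The product of the algebra of linear forms on \<open>\<pi>\<^sub>0\<close>, dual to the coproduct. A linear form is given by
  its values on monomials; the unit is the counit.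
\<close>
definition convolution ::
    "('x multiset \<Rightarrow> 'a) \<Rightarrow> ('x multiset \<Rightarrow> 'a) \<Rightarrow> 'x multiset \<Rightarrow> 'a::comm_ring_1"
  where "convolution F G n = sweedler n (\<lambda>p q. F p * G q)"

definition counit :: "'x multiset \<Rightarrow> 'a::comm_ring_1"
  where "counit n = (if n = {#} then 1 else 0)"

lemma zero_power_size: "0 ^ size m = counit m"
  by (cases m) (simp_all add: counit_def)

lemma pi0_counit_basis: "pi0_counit (basis m) = counit m"
  unfolding pi0_counit_def by (subst mpoly_eval_single) (simp_all add: zero_power_size)

lemma pi0_counit_one [simp]: "pi0_counit 1 = 1"
  using pi0_counit_basis[of "{#}"] by (simp add: counit_def)

lemma single_counit: "single 0 (counit m) = counit m"
  by (simp add: counit_def)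

text \<open>
  The linear forms that vanish on \<open>1\<close> and on products of two or more generators, i.e. the
  derivations of \<open>\<pi>\<^sub>0\<close> over the counit (\<open>primitive_form_union\<close>).
\<close>
definition primitive_form :: "('x \<Rightarrow> 'a) \<Rightarrow> 'x multiset \<Rightarrow> 'a::comm_ring_1"
  where "primitive_form f n = (if size n = 1 then \<Sum>l\<in>#n. f l else 0)"

lemma convolution_counit [simp]: "convolution counit F = F"
proof
  fix n
  have "convolution counit F n = sweedler n (\<lambda>p q. if p = {#} then F q else 0)"
    unfolding convolution_def by (rule arg_cong[where f = "sweedler n"]) (auto simp: counit_def)
  then show "convolution counit F n = F n"
    by (simp add: sweedler_counit)
qed

lemma convolution_assoc: "convolution (convolution F G) H = convolution F (convolution G H)"
proof
  fix n
  show "convolution (convolution F G) H n = convolution F (convolution G H) n"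
    using sweedler_coassoc[of n "\<lambda>s t u. F s * G t * H u"]
    by (simp add: convolution_def sweedler_mult mult.assoc)
qed

lemma convolution_commute: "convolution F G = convolution G F"
  unfolding convolution_def by (rule ext, subst sweedler_cocommute) (simp add: mult.commute)

lemma convolution_left_commute:
  "convolution F (convolution G H) = convolution G (convolution F H)"
  by (metis convolution_assoc convolution_commute)

lemma primitive_form_union:
  "primitive_form f (p + q) = primitive_form f p * counit q + counit p * primitive_form f q"
  by (cases "p = {#}"; cases "q = {#}")
    (auto simp: primitive_form_def counit_def add_is_1 dest: size_eq_0_iff_empty[THEN iffD1])

text \<open>
  A bicharacter \<open>r\<close> is the same thing as an algebra homomorphism \<open>u \<mapsto> r(u \<otimes> -)\<close> from \<open>\<pi>\<^sub>0\<close> to the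
  convolution algebra that sends primitive elements to derivations over the counit. As \<open>\<pi>\<^sub>0\<close> is free,
  such a homomorphism is given by an arbitrary matrix \<open>a k l\<close>, the value on a pair of generators.
  \<open>pairing a m\<close> is the image of the monomial \<open>m\<close>, so the multiplicativity \<open>pairing_union\<close> in the first
  argument holds by construction. Explicitly, \<open>pairing a m n\<close> is the permanent of the submatrix of
  \<open>a\<close> with rows \<open>m\<close> and columns \<open>n\<close>, or zero if the sizes of \<open>m\<close> and \<open>n\<close> differ.
\<close>
definition pairing :: "('x \<Rightarrow> 'y \<Rightarrow> 'a::comm_ring_1) \<Rightarrow> 'x multiset \<Rightarrow> 'y multiset \<Rightarrow> 'a"
  where "pairing a = fold_mset (\<lambda>k. convolution (primitive_form (a k))) counit"

lemma pairing_empty [simp]: "pairing a {#} = counit"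
  by (simp add: pairing_def)

lemma pairing_add_mset:
  "pairing a (add_mset k m) = convolution (primitive_form (a k)) (pairing a m)"
proof -
  interpret comp_fun_commute "\<lambda>k. convolution (primitive_form (a k))"
    by standard (simp add: fun_eq_iff convolution_left_commute)
  show ?thesis
    by (simp add: pairing_def)
qed

lemma pairing_union: "pairing a (m + m') = convolution (pairing a m) (pairing a m')"
  by (induction m) (simp_all add: pairing_add_mset convolution_assoc)

text \<open>
  Multiplicativity in the second argument is not built into the construction. For a single generator
  in the first argument it is the derivation rule for \<open>primitive_form (a k)\<close>, and it passes to convolution
  products because the coproducts of \<open>n\<close> and \<open>n'\<close> can be taken separately.
\<close>
lemma pairing_union_right:
  "pairing a m (n + n') = sweedler m (\<lambda>p q. pairing a p n * pairing a q n')"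
proof (induction m arbitrary: n n')
  case empty
  show ?case
    by (simp add: counit_def)
next
  case (add k m)
  let ?f = "primitive_form (a k)" and ?P = "pairing a"
  have "?P (add_mset k m) (n + n') =
      sweedler n (\<lambda>s t. sweedler n' (\<lambda>s' t'. ?f (s + s') * ?P m (t + t')))"
    by (simp add: pairing_add_mset convolution_def sweedler_union)
  also have "\<dots> = sweedler n (\<lambda>s t. sweedler n' (\<lambda>s' t'. sweedler m (\<lambda>p q.
      (?f s * ?P p t) * (counit s' * ?P q t') + (counit s * ?P p t) * (?f s' * ?P q t'))))"
    by (simp add: add.IH primitive_form_union sweedler_mult sweedler_add algebra_simps)
  \<comment> \<open>The sum over \<open>m\<close> is moved outside, so that the inner sums become convolution products.\<close>
  also have "\<dots> = sweedler m (\<lambda>p q. sweedler n (\<lambda>s t. sweedler n' (\<lambda>s' t'.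
      (?f s * ?P p t) * (counit s' * ?P q t') + (counit s * ?P p t) * (?f s' * ?P q t'))))"
    by (subst (2) sweedler_swap, subst sweedler_swap) (rule refl)
  also have "\<dots> = sweedler m (\<lambda>p q.
      convolution ?f (?P p) n * convolution counit (?P q) n' +
      convolution counit (?P p) n * convolution ?f (?P q) n')"
    unfolding sweedler_add convolution_def sweedler_product ..
  also have "\<dots> = sweedler (add_mset k m) (\<lambda>p q. ?P p n * ?P q n')"
    by (simp add: sweedler_add_mset pairing_add_mset)
  finally show ?case .
qed

lemma pairing_singleton: "pairing a {#k#} n = primitive_form (a k) n"
  by (simp add: pairing_add_mset convolution_commute[of _ counit])

lemma pairing_empty_right: "pairing a m {#} = counit m"
  by (cases m) (simp_all add: counit_def pairing_add_mset convolution_def primitive_form_def)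

lemma bicharacterD:
  assumes "bicharacter r"
  shows "linear_map (\<lambda>u. r u w)" "linear_map (r u)"
    "r u 1 = single 0 (pi0_counit u)" "r 1 u = single 0 (pi0_counit u)"
    "r (u * v) (basis n) = sweedler n (\<lambda>p q. r u (basis p) * r v (basis q))"
    "r (basis n) (u * v) = sweedler n (\<lambda>p q. r (basis p) u * r (basis q) v)"
  using assms unfolding bicharacter_def by (simp_all add: lin_ext_pi0_coprod)

text \<open>
  A generator is primitive, so pairing with it is a derivation over the counit.
\<close>
lemma bicharacter_generator:
  assumes r: "bicharacter r"
  shows "r (basis {#k#}) (basis n) = primitive_form (\<lambda>l. r (basis {#k#}) (basis {#l#})) n"
proof (cases n)
  case empty
  show ?thesis
    using bicharacterD(3)[OF r, of "basis {#k#}"]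
    by (simp add: empty primitive_form_def pi0_counit_basis single_counit counit_def)
next
  case (add l n')
  have "r (basis {#k#}) (basis n) = sweedler {#k#} (\<lambda>p q. r (basis p) (basis {#l#}) * r (basis q) (basis n'))"
    unfolding add by (subst basis_add_mset) (rule bicharacterD(6)[OF r])
  then show ?thesis
    by (simp add: add sweedler_add_mset bicharacterD(4)[OF r] pi0_counit_basis single_counit counit_def primitive_form_def)
qed

lemma bicharacter_basis:
  assumes r: "bicharacter r"
  shows "r (basis m) (basis n) = pairing (\<lambda>k l. r (basis {#k#}) (basis {#l#})) m n"
proof (induction m arbitrary: n)
  case empty
  show ?case
    using bicharacterD(4)[OF r, of "basis n"]
    by (simp add: pi0_counit_basis single_counit)
next
  case (add k m)
  show ?case
    by (subst basis_add_mset)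
      (simp only: bicharacterD(5)[OF r] add.IH bicharacter_generator[OF r, symmetric]
        pairing_add_mset convolution_def)
qed

definition bichar_of :: "(nat \<Rightarrow> nat \<Rightarrow> 'r laurent) \<Rightarrow> 'r::comm_ring_1 pi0 \<Rightarrow> 'r pi0 \<Rightarrow> 'r laurent"
  where "bichar_of a u w = lin_ext (\<lambda>m. lin_ext (pairing a m) w) u"

lemma bichar_of_basis: "bichar_of a (basis m) (basis n) = pairing a m n"
  by (simp add: bichar_of_def lin_ext_single)

lemma linear_map_bichar_of: "linear_map (\<lambda>u. bichar_of a u w)" "linear_map (bichar_of a u)"
  unfolding bichar_of_def by (intro linear_map_lin_ext linear_map_lin_ext_fun)+

lemma bicharacter_bichar_of: "bicharacter (bichar_of a)"
  unfolding bicharacter_def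
proof (intro conjI allI linear_map_bichar_of)
  note lin = linear_map_bichar_of linear_map_comp[OF linear_map_bichar_of(1)]
    linear_map_comp[OF linear_map_bichar_of(2)]
  have counit: "linear_map (\<lambda>u. single 0 (pi0_counit u) :: 'a laurent)"
  proof -
    have "single 0 (lookup u m * counit m) = single 0 (lookup u m) * (counit m :: 'a laurent)"
      for u :: "'a pi0" and m
      by (cases "m = {#}") (simp_all add: counit_def)
    then have "single 0 (pi0_counit u) = lin_ext (\<lambda>m. counit m :: 'a laurent) u" for u
      by (simp add: pi0_counit_def mpoly_eval_def lin_ext_def smul_def zero_power_size
          additive.sum[OF additive_single])
    then show ?thesis
      by (simp add: linear_map_lin_ext)
  qed
  fix u v w :: "'a pi0"
  show "bichar_of a u 1 = single 0 (pi0_counit u)"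
  proof (rule linear_map_eqI[where f = "\<lambda>u. bichar_of a u 1"])
    show "bichar_of a (basis k) 1 = single 0 (pi0_counit (basis k))" for k
      using bichar_of_basis[of a k "{#}"]
      by (simp add: pi0_counit_basis single_counit pairing_empty_right)
  qed (intro lin counit)+
  show "bichar_of a 1 u = single 0 (pi0_counit u)"
  proof (rule linear_map_eqI[where f = "\<lambda>u. bichar_of a 1 u"])
    show "bichar_of a 1 (basis k) = single 0 (pi0_counit (basis k))" for k
      using bichar_of_basis[of a "{#}" k] by (simp add: pi0_counit_basis single_counit)
  qed (intro lin counit)+
  show "bichar_of a (u * v) w =
      lin_ext (\<lambda>(p, q). bichar_of a u (basis p) * bichar_of a v (basis q)) (pi0_coprod w)"
  proof (rule linear_map_eqI[where f = "bichar_of a (u * v)"])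
    fix n
    show "bichar_of a (u * v) (basis n) =
        lin_ext (\<lambda>(p, q). bichar_of a u (basis p) * bichar_of a v (basis q)) (pi0_coprod (basis n))"
    proof (rule bilinear_eqI[where F = "\<lambda>u v. bichar_of a (u * v) (basis n)"])
      show "bichar_of a (basis k * basis l) (basis n) = lin_ext (\<lambda>(p, q).
          bichar_of a (basis k) (basis p) * bichar_of a (basis l) (basis q)) (pi0_coprod (basis n))"
        for k l
        by (simp add: mult_single bichar_of_basis lin_ext_pi0_coprod pairing_union convolution_def)
    qed (unfold case_prod_beta, (intro lin linear_map_lin_ext_fun linear_map_intros)+)
  qed (intro lin linear_map_comp[OF linear_map_lin_ext] pi0_coprod_linear)+
  show "bichar_of a w (u * v) =
      lin_ext (\<lambda>(p, q). bichar_of a (basis p) u * bichar_of a (basis q) v) (pi0_coprod w)"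
  proof (rule linear_map_eqI[where f = "\<lambda>w. bichar_of a w (u * v)"])
    fix n
    show "bichar_of a (basis n) (u * v) =
        lin_ext (\<lambda>(p, q). bichar_of a (basis p) u * bichar_of a (basis q) v) (pi0_coprod (basis n))"
    proof (rule bilinear_eqI[where F = "\<lambda>u v. bichar_of a (basis n) (u * v)"])
      show "bichar_of a (basis n) (basis k * basis l) = lin_ext (\<lambda>(p, q).
          bichar_of a (basis p) (basis k) * bichar_of a (basis q) (basis l)) (pi0_coprod (basis n))"
        for k l
        by (simp add: mult_single bichar_of_basis lin_ext_pi0_coprod pairing_union_right)
    qed (unfold case_prod_beta, (intro lin linear_map_lin_ext_fun linear_map_intros)+)
  qed (intro lin linear_map_comp[OF linear_map_lin_ext] pi0_coprod_linear)+
qed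

section \<open>Invariant bicharacters\<close>

lemma bicharacter_swap: "bicharacter r \<Longrightarrow> bicharacter (\<lambda>u w. r w u)"
  unfolding bicharacter_def by (simp add: conj_commute)

text \<open>
  The \<open>D\<^sup>(\<^sup>i\<^sup>)\<close> on \<open>\<pi>\<^sub>0\<close> and the operators \<open>D i\<close> on the values of \<open>r\<close> obey the Leibniz rule, and a bicharacter turns
  products into convolution products. So if \<open>r\<close> intertwines them on generators, it intertwines them
  everywhere. Only one variable is treated, since the other one follows with \<open>bicharacter_swap\<close>, and since
  invariance under \<open>H\<^sub>a \<otimes> H\<^sub>a\<close> is invariance in each variable.
\<close>
lemma bicharacter_hasse:
  assumes r: "bicharacter r"
    and D: "\<And>i. linear_map (D i)" "\<And>i f g. D i (f * g) = (\<Sum>j\<le>i. D j f * D (i - j) g)"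
      "\<And>i. D i 1 = (if i = 0 then 1 else 0)"
    and gen: "\<And>i k l. r (hasse i (basis {#k#})) (basis {#l#}) = D i (r (basis {#k#}) (basis {#l#}))"
  shows "r (hasse i u) w = D i (r u w)"
proof -
  have zero: "D i 0 = 0" for i
    by (rule additive.zero[OF linear_map_additive[OF D(1)]])
  have gen': "r (hasse i (basis {#k#})) (basis p) = D i (r (basis {#k#}) (basis p))" for i k p
  proof (cases "size p = 1")
    case True
    then show ?thesis
      using gen by (metis One_nat_def size_1_singleton_mset)
  next
    case False
    then have "r (basis {#k#}) (basis p) = 0" for k
      using bicharacter_generator[OF r, of k p] by (simp add: primitive_form_def)
    then show ?thesis
      by (simp add: hasse_generator linear_map_scale[OF bicharacterD(1)[OF r]] zero smul_zero)
  qed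
  have basis: "r (hasse i (basis m)) (basis n) = D i (r (basis m) (basis n))" for i m n
  proof (induction m arbitrary: i n)
    case empty
    show ?case
      using bicharacterD(4)[OF r, of "basis n"] additive.zero[OF linear_map_additive[OF bicharacterD(1)[OF r]]]
      by (simp add: hasse_one D(3) zero pi0_counit_basis single_counit counit_def)
  next
    case (add k m)
    have "r (hasse i (basis {#k#} * basis m)) (basis n) =
        (\<Sum>j\<le>i. r (hasse j (basis {#k#}) * hasse (i - j) (basis m)) (basis n))"
      by (simp add: hasse_mult additive.sum[OF linear_map_additive[OF bicharacterD(1)[OF r]]])
    also have "\<dots> = sweedler n (\<lambda>p q. \<Sum>j\<le>i. r (hasse j (basis {#k#})) (basis p) *
        r (hasse (i - j) (basis m)) (basis q))"
      by (simp add: bicharacterD(5)[OF r] sweedler_sum)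
    also have "\<dots> = sweedler n (\<lambda>p q. D i (r (basis {#k#}) (basis p) * r (basis m) (basis q)))"
      by (simp add: gen' add.IH D(2))
    also have "\<dots> = D i (r (basis {#k#} * basis m) (basis n))"
      by (simp add: bicharacterD(5)[OF r] sweedler_additive[OF linear_map_additive[OF D(1)]])
    finally show ?case
      by (simp add: mult_single)
  qed
  show ?thesis
    by (rule bilinear_eqI[where F = "\<lambda>u w. r (hasse i u) w" and G = "\<lambda>u w. D i (r u w)"])
      (intro basis bicharacterD(1,2)[OF r] linear_map_comp[OF bicharacterD(1)[OF r]] hasse_linear
        linear_map_comp[OF D(1)])+
qed

text \<open>
  Since \<open>b\<^bsub>-(k+1)\<^esub>v\<^sub>0 = D\<^sup>(\<^sup>k\<^sup>)(b\<^sub>-\<^sub>1v\<^sub>0)\<close>, invariance forces these values on pairs of generators.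
\<close>
definition heisenberg_matrix :: "'r \<Rightarrow> nat \<Rightarrow> nat \<Rightarrow> 'r::comm_ring_1 laurent"
  where "heisenberg_matrix c k l = ddx1 k (ddx2 l (single (- 2) c))"

lemma ddx1_one: "ddx1 i 1 = (if i = 0 then 1 else 0)" and ddx2_one: "ddx2 i 1 = (if i = 0 then 1 else 0)"
  using ddx1_single[of i 0 1] ddx2_single[of i 0 1] by (cases "i = 0"; simp)+

lemma Ha_invariant_heisenberg: "Ha_invariant (bichar_of (heisenberg_matrix c))"
proof -
  let ?r = "bichar_of (heisenberg_matrix c)"
  have gens: "?r (basis {#k#}) (basis {#l#}) = heisenberg_matrix c k l" for k l
    by (simp add: bichar_of_basis pairing_singleton primitive_form_def)
  have 1: "?r (hasse i u) w = ddx1 i (?r u w)" for i u w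
  proof (rule bicharacter_hasse[where D = ddx1, OF bicharacter_bichar_of])
    show "?r (hasse i (basis {#k#})) (basis {#l#}) = ddx1 i (?r (basis {#k#}) (basis {#l#}))" for i k l
      by (simp add: hasse_generator linear_map_scale[OF linear_map_bichar_of(1)] gens
          heisenberg_matrix_def ddx1_ddx1 add.commute)
  qed (intro linear_map_ddx1 ddx1_mult ddx1_one)+
  have 2: "?r w (hasse i u) = ddx2 i (?r w u)" for i u w
  proof (rule bicharacter_hasse[where r = "\<lambda>u w. ?r w u" and D = ddx2,
        OF bicharacter_swap[OF bicharacter_bichar_of]])
    show "?r (basis {#l#}) (hasse i (basis {#k#})) = ddx2 i (?r (basis {#l#}) (basis {#k#}))" for i k l
      by (simp add: hasse_generator linear_map_scale[OF linear_map_bichar_of(2)] gens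
          heisenberg_matrix_def ddx1_ddx2_commute ddx2_ddx2 add.commute)
  qed (intro linear_map_ddx2 ddx2_mult ddx2_one)+
  show ?thesis
    by (simp add: Ha_invariant_def 1 2 ddx1_ddx2_commute)
qed

definition heisenberg_bicharacter :: "'r \<Rightarrow> ('r::comm_ring_1 pi0 \<Rightarrow> 'r pi0 \<Rightarrow> 'r laurent) \<Rightarrow> bool"
  where "heisenberg_bicharacter c r \<longleftrightarrow>
    bicharacter r \<and> Ha_invariant r \<and> r (bneg 1) (bneg 1) = single (- 2) c"

lemma heisenberg_bicharacter_basis:
  assumes r: "heisenberg_bicharacter c r"
  shows "r (basis m) (basis n) = pairing (heisenberg_matrix c) m n"
proof -
  have "r (basis {#k#}) (basis {#l#}) = heisenberg_matrix c k l" for k l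
  proof -
    have "hasse i (bneg 1) = basis {#i#}" for i
      using hasse_bneg[of 1 i] by (simp add: bneg_def)
    then show ?thesis
      using r unfolding heisenberg_bicharacter_def Ha_invariant_def heisenberg_matrix_def by metis
  qed
  with bicharacter_basis[of r] r show ?thesis
    by (simp add: heisenberg_bicharacter_def)
qed

lemma heisenberg_bicharacter_bichar_of:
  "heisenberg_bicharacter c (bichar_of (heisenberg_matrix c))"
  unfolding heisenberg_bicharacter_def
proof (intro conjI bicharacter_bichar_of Ha_invariant_heisenberg)
  have "bichar_of (heisenberg_matrix c) (bneg 1) (bneg 1) = heisenberg_matrix c 0 0"
    by (simp add: bneg_def bichar_of_basis pairing_singleton primitive_form_def)
  then show "bichar_of (heisenberg_matrix c) (bneg 1) (bneg 1) = single (- 2) c"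
    by (simp add: heisenberg_matrix_def ddx1_single ddx2_single)
qed

lemma heisenberg_bicharacter_unique:
  assumes r: "heisenberg_bicharacter c r"
  shows "r = bichar_of (heisenberg_matrix c)"
proof (intro ext)
  have b: "bicharacter r"
    using r by (simp add: heisenberg_bicharacter_def)
  fix u w
  show "r u w = bichar_of (heisenberg_matrix c) u w"
  proof (rule bilinear_eqI[where F = r and G = "bichar_of (heisenberg_matrix c)"])
    show "r (basis m) (basis n) = bichar_of (heisenberg_matrix c) (basis m) (basis n)" for m n
      by (simp only: bichar_of_basis heisenberg_bicharacter_basis[OF r])
  qed (rule bicharacterD(1)[OF b] bicharacterD(2)[OF b] linear_map_bichar_of)+
qed

section \<open>Heisenberg modes\<close>

text \<open>
  The derivation \<open>\<partial>/\<partial>b\<^bsub>-(l+1)\<^esub>\<close> of \<open>\<pi>\<^sub>0\<close>.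
\<close>
definition partial :: "nat \<Rightarrow> 'r::comm_ring_1 pi0 \<Rightarrow> 'r pi0"
  where "partial l = lin_ext (\<lambda>n. single (n - {#l#}) (of_nat (count n l)))"

lemma linear_map_partial: "linear_map (partial l)"
  unfolding partial_def by (rule linear_map_lin_ext)

lemma partial_mult:
  "partial l (basis {#k#} * w) = (if k = l then w else 0) + basis {#k#} * partial l w"
proof (rule linear_map_eqI[where f = "\<lambda>w. partial l (basis {#k#} * w)"
      and g = "\<lambda>w. (if k = l then w else 0) + basis {#k#} * partial l w"])
  show "linear_map (\<lambda>w. (if k = l then w else 0) + basis {#k#} * partial l w)"
    by (intro linear_map_add linear_map_comp[OF linear_map_mult(1)] linear_map_partial)
      (cases "k = l"; simp add: linear_map_id linear_map_zero)
  fix n :: "nat multiset"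
  show "partial l (basis {#k#} * basis n) =
      (if k = l then basis n else 0) + basis {#k#} * partial l (basis n)"
    by (cases "l \<in># n")
      (auto simp: partial_def mult_single lin_ext_single single_add not_in_iff add.commute)
qed (intro linear_map_comp[OF linear_map_partial] linear_map_mult)

lemma partial_one: "partial l 1 = 0"
  using lin_ext_single[of "\<lambda>n. single (n - {#l#}) (of_nat (count n l))" "{#}" 1]
  by (simp add: partial_def)

lemma partial_commute: "partial k (partial l w) = partial l (partial k w)"
  by (rule linear_map_pi0_eqI[where f = "\<lambda>w. partial k (partial l w)"
        and g = "\<lambda>w. partial l (partial k w)"])
    (auto simp: partial_one partial_mult additive.add[OF linear_map_additive[OF linear_map_partial]]
      additive.zero[OF linear_map_additive[OF linear_map_partial]]
      intro!: linear_map_comp[OF linear_map_partial] linear_map_partial)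

lemma hasse_0: "hasse 0 u = u"
  by (rule linear_map_pi0_eqI[OF hasse_linear linear_map_id])
    (simp_all add: hasse_one hasse_mult hasse_generator)

lemma hasse_1_mult:
  fixes w :: "'a::comm_ring_1 pi0"
  shows "hasse 1 (basis {#k#} * w) =
    smul (of_nat (Suc k)) (basis {#Suc k#} * w) + basis {#k#} * hasse 1 w"
proof -
  have "hasse 1 (basis {#k#} :: 'a pi0) = of_nat (Suc k) * basis {#Suc k#}"
    by (simp only: hasse_generator smul_of_nat) simp
  then show ?thesis
    unfolding smul_of_nat by (simp add: hasse_mult hasse_0 mult.assoc)
qed

text \<open>
  \<open>T\<close> sends \<open>b\<^bsub>-l\<^esub>\<close> to \<open>l b\<^bsub>-(l+1)\<^esub>\<close>, so the derivation \<open>[T, \<partial>/\<partial>b\<^bsub>-(l+1)\<^esub>]\<close> is nonzero only on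
  \<open>b\<^bsub>-l\<^esub>\<close>. For \<open>l = 0\<close> both sides vanish, whatever the truncated difference \<open>l - 1\<close> is.
\<close>
lemma partial_hasse_1:
  "hasse 1 (partial l w) - partial l (hasse 1 w) = - smul (of_nat l) (partial (l - 1) w)"
proof -
  note add = additive.add[OF linear_map_additive[OF hasse_linear]]
    additive.add[OF linear_map_additive[OF linear_map_partial]]
    additive.zero[OF linear_map_additive[OF hasse_linear]]
    additive.zero[OF linear_map_additive[OF linear_map_partial]]
  have "hasse 1 (partial l w) = partial l (hasse 1 w) - smul (of_nat l) (partial (l - 1) w)"
  proof (rule linear_map_pi0_eqI[where f = "\<lambda>w. hasse 1 (partial l w)"
        and g = "\<lambda>w. partial l (hasse 1 w) - smul (of_nat l) (partial (l - 1) w)"])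
    fix k and w :: "'a pi0"
    assume IH: "hasse 1 (partial l w) = partial l (hasse 1 w) - smul (of_nat l) (partial (l - 1) w)"
    have "hasse 1 (partial l (basis {#k#} * w)) =
        (if k = l then hasse 1 w else 0) + smul (of_nat (Suc k)) (basis {#Suc k#} * partial l w) +
        basis {#k#} * hasse 1 (partial l w)"
      by (simp only: partial_mult add hasse_1_mult if_distrib[of "hasse 1"] add.assoc)
    moreover have "partial l (hasse 1 (basis {#k#} * w)) =
        smul (of_nat (Suc k)) (if Suc k = l then w else 0) +
        smul (of_nat (Suc k)) (basis {#Suc k#} * partial l w) +
        (if k = l then hasse 1 w else 0) + basis {#k#} * partial l (hasse 1 w)"
      by (simp only: partial_mult add hasse_1_mult linear_map_scale[OF linear_map_partial]
          add.assoc module.scale_right_distrib[OF module_smul])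
    moreover have "smul (of_nat l) (partial (l - 1) (basis {#k#} * w)) =
        smul (of_nat (Suc k)) (if Suc k = l then w else 0) +
        basis {#k#} * smul (of_nat l) (partial (l - 1) w)"
      by (cases l) (auto simp: partial_mult smul_def distrib_left mult.left_commute)
    ultimately show "hasse 1 (partial l (basis {#k#} * w)) = partial l (hasse 1 (basis {#k#} * w)) -
        smul (of_nat l) (partial (l - 1) (basis {#k#} * w))"
      by (simp only: IH right_diff_distrib) (simp add: algebra_simps)
  qed (simp_all add: partial_one hasse_one add smul_zero linear_map_comp[OF hasse_linear linear_map_partial]
      linear_map_diff linear_map_smul linear_map_partial linear_map_comp[OF linear_map_partial hasse_linear])
  then show ?thesis
    by simp
qed

text \<open>
  The Heisenberg operators: creation operators multiply, and \<open>b\<^sub>n\<close> for \<open>n > 0\<close> is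
  \<open>c n \<partial>/\<partial>b\<^bsub>-n\<^esub>\<close>. For \<open>n = 0\<close> the scalar is zero, so the junk index \<open>nat 0 - 1\<close> does no harm.
\<close>
definition mode :: "'r \<Rightarrow> int \<Rightarrow> 'r::comm_ring_1 pi0 \<Rightarrow> 'r pi0"
  where "mode c n w =
    (if n < 0 then bneg (nat (- n)) * w else smul (c * of_int n) (partial (nat n - 1) w))"

lemma mode_neg: "mode c (- int (Suc k)) w = basis {#k#} * w"
  by (simp only: mode_def bneg_def minus_minus nat_int) simp

lemma linear_map_mode: "linear_map (mode c n)"
  by (cases "n < 0")
    (simp_all add: mode_def[abs_def] linear_map_mult linear_map_smul linear_map_partial)

lemma mode_commutator:
  "mode c m (mode c n w) - mode c n (mode c m w) =
    smul (if m + n = 0 then c * of_int m else 0) w"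
proof -
  have smul0: "smul 0 w = 0" for w :: "'a pi0"
    by (simp add: smul_def)
  \<comment> \<open>The one case with a nonzero scalar, up to exchanging \<open>m\<close> and \<open>n\<close>.\<close>
  have mixed: "mode c m (mode c n w) - mode c n (mode c m w) =
      smul (if m + n = 0 then c * of_int m else 0) w" if "m \<ge> 0" "n < 0" for m n w
  proof -
    have bn: "bneg (nat (- n)) = basis {#nat (- n) - 1#}"
      by (simp add: bneg_def)
    have "mode c m (mode c n w) = smul (c * of_int m)
        ((if nat (- n) - 1 = nat m - 1 then w else 0) + bneg (nat (- n)) * partial (nat m - 1) w)"
      using that by (simp add: mode_def bn partial_mult)
    moreover have "mode c n (mode c m w) =
        smul (c * of_int m) (bneg (nat (- n)) * partial (nat m - 1) w)"
      using that by (simp add: mode_def smul_def mult_ac)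
    moreover have "nat (- n) - 1 = nat m - 1 \<longleftrightarrow> m + n = 0" if "m \<noteq> 0"
      using that \<open>m \<ge> 0\<close> \<open>n < 0\<close> by linarith
    ultimately show ?thesis
      by (cases "m = 0") (auto simp: module.scale_right_distrib[OF module_smul] smul0 smul_zero that)
  qed
  consider "m < 0" "n < 0" | "m \<ge> 0" "n < 0" | "m < 0" "n \<ge> 0" | "m \<ge> 0" "n \<ge> 0"
    by linarith
  then show ?thesis
  proof cases
    case 1
    then show ?thesis
      by (simp add: mode_def mult_ac smul0)
  next
    case 2
    then show ?thesis
      by (rule mixed)
  next
    case 3
    have "c * of_int n = - (c * of_int m)" if "m + n = 0"
    proof -
      have "n = - m" using that by simp
      then show ?thesis by simp
    qed
    moreover have "smul (- a) w = - smul a w" for a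
      by (simp add: smul_def single_uminus)
    ultimately show ?thesis
      using mixed[OF 3(2,1), of w] by (auto simp: algebra_simps smul0)
  next
    case 4
    show ?thesis
    proof (cases "m + n = 0")
      case True
      with 4 have "m = 0" "n = 0"
        by linarith+
      then show ?thesis
        by (simp add: mode_def smul0)
    next
      case False
      with 4 show ?thesis
        by (simp add: mode_def linear_map_scale[OF linear_map_partial] smul_smul mult_ac
            partial_commute[of "nat m - Suc 0"] smul0)
    qed
  qed
qed

lemma heisenberg_modes_mode: "heisenberg_modes c (mode c)"
  unfolding heisenberg_modes_def
  by (auto simp: linear_map_mode mode_commutator) (simp_all add: mode_def partial_one smul_zero)

text \<open>
  For \<open>n \<ge> 0\<close> the operator \<open>b\<^sub>n\<close> kills the vacuum, and its commutators with the creation operators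
  are prescribed scalars; this determines it on everything that the creation operators generate.
\<close>
lemma heisenberg_modes_unique:
  assumes b: "heisenberg_modes c b"
  shows "b = mode c"
proof (intro ext)
  fix n and w :: "'a pi0"
  have neg: "b (- int (Suc k)) v = mode c (- int (Suc k)) v" for k v
  proof -
    have "b (- int (Suc k)) v = bneg (Suc k) * v"
      using b unfolding heisenberg_modes_def by (metis le_add1 plus_1_eq_Suc)
    then show ?thesis
      unfolding mode_neg by (simp add: bneg_def)
  qed
  note gen = mode_neg[symmetric, of _ _ c]
  show "b n w = mode c n w"
  proof (cases "n < 0")
    case True
    then show ?thesis
      using neg[of "nat (- n) - 1"] by (simp add: of_nat_diff)
  next
    case False
    show ?thesis
    proof (rule linear_map_pi0_eqI[where f = "b n" and g = "mode c n"])
      show "b n 1 = mode c n 1"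
        using b False by (simp add: heisenberg_modes_def mode_def partial_one smul_zero)
    next
      fix k v
      assume IH: "b n v = mode c n v"
      have "b n (b (- int (Suc k)) v) - b (- int (Suc k)) (b n v) =
          mode c n (mode c (- int (Suc k)) v) - mode c (- int (Suc k)) (mode c n v)"
        using b unfolding mode_commutator by (simp add: heisenberg_modes_def)
      then show "b n (basis {#k#} * v) = mode c n (basis {#k#} * v)"
        by (simp only: neg IH gen) simp
    qed (use b in \<open>simp_all add: heisenberg_modes_def linear_map_mode\<close>)
  qed
qed

lemma hasse_1_mode: "hasse 1 (mode c n w) - mode c n (hasse 1 w) = - (of_int n * mode c (n - 1) w)"
proof (cases "n < 0")
  case True
  then obtain k where k: "n = - int (Suc k)"
    by (metis negD)
  have "hasse 1 (mode c n w) - mode c n (hasse 1 w) = of_nat (Suc k) * (basis {#Suc k#} * w)"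
    unfolding k mode_neg hasse_1_mult smul_of_nat by simp
  moreover have "mode c (n - 1) w = basis {#Suc k#} * w"
    using mode_neg[of c "Suc k" w] by (simp add: k)
  ultimately show ?thesis
    by (simp add: k algebra_simps)
next
  case False
  then obtain k where k: "n = int k"
    by (metis nonneg_int_cases not_less)
  show ?thesis
  proof (cases k)
    case 0
    then show ?thesis
      by (simp add: k mode_def smul_def additive.zero[OF linear_map_additive[OF hasse_linear]])
  next
    case (Suc l)
    have "hasse 1 (mode c n w) - mode c n (hasse 1 w) =
        smul (c * of_int n) (hasse 1 (partial l w) - partial l (hasse 1 w))"
      by (simp add: k Suc mode_def linear_map_scale[OF hasse_linear]
          module.scale_right_diff_distrib[OF module_smul] nat_add_distrib)
    also have "\<dots> = - smul (c * of_int n) (smul (of_nat l) (partial (l - 1) w))"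
      unfolding partial_hasse_1 by (simp add: smul_def)
    also have "\<dots> = - smul (of_int n) (smul (c * of_nat l) (partial (l - 1) w))"
      by (simp add: smul_smul mult_ac)
    also have "smul (c * of_nat l) (partial (l - 1) w) = mode c (n - 1) w"
      by (simp add: k Suc mode_def)
    also have "smul (of_int n) (mode c (n - 1) w) = of_int n * mode c (n - 1) w"
      by (rule smul_of_int)
    finally show ?thesis .
  qed
qed

text \<open>
  As for the modes, the commutators with creation operators determine \<open>T\<close> from \<open>T v\<^sub>0 = 0\<close>.
\<close>
lemma translation_unique:
  assumes t: "linear_map t" "t 1 = 0"
    and comm: "\<And>n w. t (mode c n w) - mode c n (t w) = - (of_int n * mode c (n - 1) w)"
  shows "t = hasse 1"
proof
  fix u
  show "t u = hasse 1 u"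
  proof (rule linear_map_pi0_eqI[OF t(1) hasse_linear])
    fix k w
    assume IH: "t w = hasse 1 w"
    note gen = mode_neg[symmetric, of k _ c]
    show "t (basis {#k#} * w) = hasse 1 (basis {#k#} * w)"
      using comm[of "- int (Suc k)" w] hasse_1_mode[of c "- int (Suc k)" w]
      unfolding gen IH by (metis diff_add_cancel)
  qed (simp add: t hasse_one)
qed

section \<open>The fields of the Heisenberg vertex algebra\<close>

definition scalar :: "'r::comm_ring_1 \<Rightarrow> 'r pi0 fls"
  where "scalar a = fls_const (single 0 a)"

lemma additive_scalar: "additive scalar"
  by (simp add: additive_def scalar_def single_add flip: fls_plus_const)

lemma scalar_mult: "scalar (a * b) = scalar a * scalar b"
  by (simp add: scalar_def mult_single)

lemma scalar_one [simp]: "scalar 1 = 1"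
  by (simp add: scalar_def)

text \<open>
  \<open>f \<mapsto> f\<close> at \<open>x\<^sub>2 = 0\<close>, as a ring homomorphism from \<open>R[(x\<^sub>1 - x\<^sub>2)\<^sup>\<plusminus>\<^sup>1]\<close> to \<open>\<pi>\<^sub>0((x\<^sub>1))\<close>.
\<close>
definition expansion :: "'r::comm_ring_1 laurent \<Rightarrow> 'r pi0 fls"
  where "expansion = semilin scalar fls_X_intpow"

lemma additive_expansion: "additive expansion"
  unfolding expansion_def by (rule additive_semilin[OF additive_scalar])

lemma expansion_mult: "expansion (f * g) = expansion f * expansion g"
  unfolding expansion_def
  by (rule semilin_mult[OF additive_scalar scalar_mult])
    (simp add: fls_X_intpow_times_fls_X_intpow add.commute)

lemma expansion_single: "expansion (single n a) = scalar a * fls_X_intpow n"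
  by (simp add: expansion_def semilin_single additive_scalar)

text \<open>
  The singular product \<open>\<Sum> u'w' r(u'' \<otimes> w'')\<close> of two monomials after the Taylor expansion in \<open>x\<^sub>1\<close> and the
  substitution \<open>x\<^sub>2 = 0\<close>. Its bilinear extension \<open>state_field\<close> is the state-field correspondence of both
  vertex algebras that are to be compared.
\<close>
definition monomial_field_basis :: "'r \<Rightarrow> nat multiset \<Rightarrow> nat multiset \<Rightarrow> 'r::comm_ring_1 pi0 fls"
  where "monomial_field_basis c m n = sweedler m (\<lambda>p q. sweedler n (\<lambda>s t.
    fps_to_fls (hasse_series (basis p)) * fls_const (basis s) *
    expansion (pairing (heisenberg_matrix c) q t)))"

definition monomial_field :: "'r \<Rightarrow> nat multiset \<Rightarrow> 'r::comm_ring_1 pi0 \<Rightarrow> 'r pi0 fls"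
  where "monomial_field c m = semilin scalar (monomial_field_basis c m)"

definition state_field :: "'r \<Rightarrow> 'r pi0 \<Rightarrow> 'r::comm_ring_1 pi0 \<Rightarrow> 'r pi0 fls"
  where "state_field c u w = semilin scalar (\<lambda>m. monomial_field c m w) u"

lemma state_field_basis: "state_field c (basis m) w = monomial_field c m w"
  by (simp add: state_field_def semilin_single additive_scalar)

lemma scalar_mult_nth: "fls_nth (scalar a * f) n = smul a (fls_nth f n)"
  by (simp add: scalar_def smul_def)

lemma scalar_X_intpow_mult_nth:
  "fls_nth (scalar a * fls_X_intpow n * f) i = smul a (fls_nth f (i - n))"
  unfolding mult.assoc scalar_mult_nth fls_X_intpow_times_conv_shift(1) by simp

lemma additive_monomial_field: "additive (monomial_field c m)"
  unfolding monomial_field_def by (rule additive_semilin[OF additive_scalar])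

lemma monomial_field_smul: "monomial_field c m (smul a w) = scalar a * monomial_field c m w"
  unfolding monomial_field_def by (rule semilin_smul[OF additive_scalar scalar_mult])

lemma linear_map_state_field: "linear_map (\<lambda>u. fls_nth (state_field c u w) n)"
proof -
  have "fls_nth (state_field c (u + v) w) n = fls_nth (state_field c u w) n + fls_nth (state_field c v w) n" for u v
    by (simp add: state_field_def additive.add[OF additive_semilin[OF additive_scalar]])
  moreover have "fls_nth (state_field c (smul a u) w) n = smul a (fls_nth (state_field c u w) n)" for a u
    by (simp add: state_field_def semilin_smul[OF additive_scalar scalar_mult] scalar_mult_nth)
  ultimately show ?thesis
    by (simp add: module_hom_iff module_smul)
qed

lemma sweedler_counit': "sweedler m (\<lambda>p q. F p * counit q) = F m"
  for F :: "_ \<Rightarrow> 'a::comm_ring_1"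
  using convolution_counit[of F] convolution_commute[of F counit]
  by (metis convolution_def)

lemma hasse_series_one: "hasse_series 1 = 1"
  by (rule fps_ext) (simp add: hasse_one flip: hasse_def)

lemma monomial_field_empty: "monomial_field c {#} w = fls_const w"
proof -
  have "expansion (1 :: 'a laurent) = 1"
    using expansion_single[of 0 "1 :: 'a"] by simp
  then have one: "expansion (counit t :: 'a laurent) = counit t" for t :: "nat multiset"
    by (simp add: counit_def additive.zero[OF additive_expansion])
  have "monomial_field_basis c {#} = (\<lambda>n. fls_const (basis n))"
    by (simp add: fun_eq_iff monomial_field_basis_def hasse_series_one one sweedler_counit')
  then have "monomial_field c {#} w = semilin scalar (\<lambda>n. fls_const (basis n)) w"
    by (simp add: monomial_field_def)
  also have "\<dots> = fls_const w"
  proof (rule additive_eqI)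
    show "additive (fls_const :: 'a pi0 \<Rightarrow> _)"
      by (simp add: additive_def fls_plus_const)
    show "semilin scalar (\<lambda>n. fls_const (basis n)) (single k a) = fls_const (single k a)"
      for k and a :: 'a
      by (simp add: semilin_single additive_scalar) (simp add: scalar_def mult_single)
  qed (rule additive_semilin[OF additive_scalar])
  finally show ?thesis .
qed

text \<open>
  In the coproduct of \<open>b u\<close>, with a generator \<open>b\<close>, the factor \<open>b\<close> lands in one of two places. If it
  belongs to \<open>u'\<close>, it contributes its Taylor series, which is the creation part of its field. If it
  belongs to \<open>u''\<close>, it is paired with a part of \<open>w''\<close>, and the rest of the product is that of \<open>u\<close> with
  what remains of \<open>w\<close>. This is the annihilation part.
\<close>
lemma monomial_field_basis_add_mset:
  fixes c :: "'r::comm_ring_1"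
  shows "monomial_field_basis c (add_mset k m) n =
    fps_to_fls (hasse_series (basis {#k#})) * monomial_field_basis c m n +
    sweedler n (\<lambda>p q. expansion (primitive_form (heisenberg_matrix c k) q) * monomial_field_basis c m p)"
proof -
  let ?E = "\<lambda>p. fps_to_fls (hasse_series (basis p :: 'r pi0))" and ?P = "pairing (heisenberg_matrix c)"
  let ?f = "primitive_form (heisenberg_matrix c k)"
  \<comment> \<open>\<open>e\<close> hides the empty monomial in \<open>{#k#}\<close>, to which \<open>E\<close> would apply again.\<close>
  define e where "e = ?E {#k#}"
  have E: "?E (add_mset k p) = e * ?E p" for p
    unfolding e_def by (subst basis_add_mset) (simp only: hasse_series_mult fls_times_fps_to_fls)
  have "sweedler n (\<lambda>s t. ?E p * fls_const (basis s) * expansion (?P (add_mset k q) t)) =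
      sweedler n (\<lambda>x t. expansion (?f t) * sweedler x (\<lambda>s y.
        ?E p * fls_const (basis s) * expansion (?P q y)))" for p q
  proof -
    \<comment> \<open>Of the three places for \<open>w\<close>, the one that is paired with \<open>k\<close> is moved to the end.\<close>
    have "sweedler n (\<lambda>s t. ?E p * fls_const (basis s) * expansion (?P (add_mset k q) t)) =
        sweedler n (\<lambda>s t. sweedler t (\<lambda>x y.
          ?E p * fls_const (basis s) * (expansion (?f x) * expansion (?P q y))))"
      by (simp add: pairing_add_mset convolution_def sweedler_additive[OF additive_expansion]
          expansion_mult sweedler_mult)
    also have "\<dots> = sweedler n (\<lambda>x t. sweedler x (\<lambda>s y.
        ?E p * fls_const (basis s) * (expansion (?f t) * expansion (?P q y))))"
      by (subst sweedler_coassoc[symmetric]) (rule sweedler_coassoc_commute)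
    also have "\<dots> = sweedler n (\<lambda>x t. expansion (?f t) * sweedler x (\<lambda>s y.
        ?E p * fls_const (basis s) * expansion (?P q y)))"
      by (simp add: sweedler_mult mult_ac)
    finally show ?thesis .
  qed
  then have "sweedler m (\<lambda>p q. sweedler n (\<lambda>s t.
        ?E p * fls_const (basis s) * expansion (?P (add_mset k q) t))) =
      sweedler n (\<lambda>x t. expansion (?f t) * monomial_field_basis c m x)"
    unfolding monomial_field_basis_def by (simp add: sweedler_mult(1) sweedler_swap[of m n])
  moreover have "sweedler m (\<lambda>p q. sweedler n (\<lambda>s t.
        ?E (add_mset k p) * fls_const (basis s) * expansion (?P q t))) =
      e * monomial_field_basis c m n"
    unfolding E monomial_field_basis_def by (simp add: sweedler_mult(1) mult.assoc)
  ultimately show ?thesis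
    by (simp only: e_def monomial_field_basis_def[of c "add_mset k m"] sweedler_add_mset sweedler_add)
qed

text \<open>
  A derivation over the counit sees only the splittings that separate a single generator, and
  \<open>l\<close> can be separated in \<open>count n l\<close> ways.
\<close>
lemma sweedler_primitive_form:
  fixes G :: "'x multiset \<Rightarrow> 'a::comm_ring_1"
  assumes "finite L" "set_mset n \<subseteq> L"
  shows "sweedler n (\<lambda>p q. primitive_form g q * G p) =
    (\<Sum>l\<in>L. of_nat (count n l) * (g l * G (n - {#l#})))"
  using assms(2)
proof (induction n arbitrary: G)
  case empty
  then show ?case
    by (simp add: primitive_form_def)
next
  case (add k n)
  have "primitive_form g (add_mset k q) = g k * counit q" for q
    by (simp add: primitive_form_def counit_def)
  then have "sweedler n (\<lambda>p q. primitive_form g (add_mset k q) * G p) =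
      sweedler n (\<lambda>p q. (g k * G p) * counit q)"
    by (simp add: mult_ac)
  also have "\<dots> = (\<Sum>l\<in>L. if l = k then g k * G n else 0)"
    unfolding sweedler_counit' using add.prems assms(1) by simp
  finally have "sweedler (add_mset k n) (\<lambda>p q. primitive_form g q * G p) =
      (\<Sum>l\<in>L. of_nat (count n l) * (g l * G (add_mset k (n - {#l#}))) +
        (if l = k then g k * G n else 0))"
    using add.IH[of "\<lambda>p. G (add_mset k p)"] add.prems
    by (simp add: sweedler_add_mset sweedler_add sum.distrib)
  also have "\<dots> = (\<Sum>l\<in>L. of_nat (count (add_mset k n) l) * (g l * G (add_mset k n - {#l#})))"
  proof (rule sum.cong)
    fix l
    show "of_nat (count n l) * (g l * G (add_mset k (n - {#l#}))) + (if l = k then g k * G n else 0) =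
        of_nat (count (add_mset k n) l) * (g l * G (add_mset k n - {#l#}))"
      by (cases "l \<in># n") (auto simp: algebra_simps not_in_iff insert_DiffM)
  qed simp
  finally show ?case .
qed

lemma monomial_field_partial:
  "monomial_field c m (partial l w) =
    semilin scalar (\<lambda>n. of_nat (count n l) * monomial_field_basis c m (n - {#l#})) w"
proof (rule additive_eqI[where f = "\<lambda>w. monomial_field c m (partial l w)"])
  show "additive (\<lambda>w. monomial_field c m (partial l w))"
    by (intro additive_comp[OF additive_monomial_field] linear_map_additive[OF linear_map_partial])
  have of_nat: "scalar (of_nat i) = (of_nat i :: 'a pi0 fls)" for i
    by (simp add: scalar_def fls_of_nat)
  show "monomial_field c m (partial l (single n a)) =
      semilin scalar (\<lambda>n. of_nat (count n l) * monomial_field_basis c m (n - {#l#})) (single n a)" for n a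
    by (simp add: partial_def lin_ext_single smul_single monomial_field_def semilin_single additive_scalar
        scalar_mult of_nat mult_ac)
qed (rule additive_semilin[OF additive_scalar])

text \<open>
  The recursion \<open>monomial_field_basis_add_mset\<close> for arbitrary \<open>w\<close>. A finite set \<open>L\<close> containing all variables of \<open>w\<close> lets the
  same finite sum serve for all monomials of \<open>w\<close>.
\<close>
lemma monomial_field_add_mset:
  assumes "finite L" "\<And>n. n \<in> keys w \<Longrightarrow> set_mset n \<subseteq> L"
  shows "monomial_field c (add_mset k m) w =
    fps_to_fls (hasse_series (basis {#k#})) * monomial_field c m w +
    (\<Sum>l\<in>L. expansion (heisenberg_matrix c k l) * monomial_field c m (partial l w))"
proof -
  let ?g = "\<lambda>l. expansion (heisenberg_matrix c k l)"
  have "expansion (primitive_form (heisenberg_matrix c k) q) = primitive_form ?g q" for q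
  proof (cases "size q = 1")
    case True
    then obtain l where "q = {#l#}"
      by (metis One_nat_def size_1_singleton_mset)
    then show ?thesis
      by (simp add: primitive_form_def)
  qed (simp add: primitive_form_def additive.zero[OF additive_expansion])
  then have "monomial_field_basis c (add_mset k m) n =
      fps_to_fls (hasse_series (basis {#k#})) * monomial_field_basis c m n +
      (\<Sum>l\<in>L. ?g l * (of_nat (count n l) * monomial_field_basis c m (n - {#l#})))" if "n \<in> keys w" for n
    using sweedler_primitive_form[OF assms(1) assms(2)[OF that], of ?g "monomial_field_basis c m"]
    by (simp add: monomial_field_basis_add_mset mult.left_commute)
  then have "monomial_field c (add_mset k m) w = (\<Sum>n\<in>keys w. scalar (lookup w n) *
      (fps_to_fls (hasse_series (basis {#k#})) * monomial_field_basis c m n +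
      (\<Sum>l\<in>L. ?g l * (of_nat (count n l) * monomial_field_basis c m (n - {#l#})))))"
    by (simp add: monomial_field_def semilin_def)
  also have "\<dots> = (\<Sum>n\<in>keys w. fps_to_fls (hasse_series (basis {#k#})) *
        (scalar (lookup w n) * monomial_field_basis c m n)) +
      (\<Sum>n\<in>keys w. \<Sum>l\<in>L. ?g l *
        (scalar (lookup w n) * (of_nat (count n l) * monomial_field_basis c m (n - {#l#}))))"
    by (simp add: distrib_left sum.distrib sum_distrib_left mult.left_commute)
  also have "\<dots> = fps_to_fls (hasse_series (basis {#k#})) * monomial_field c m w +
      (\<Sum>l\<in>L. ?g l * monomial_field c m (partial l w))"
    unfolding monomial_field_partial by (subst sum.swap) (simp add: monomial_field_def semilin_def sum_distrib_left)
  finally show ?thesis .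
qed

lemma int_binomial_minus_2: "(- 1) ^ l * int_binomial (- 2) l = int (Suc l)"
proof -
  have "(2 + of_nat l - 1 :: rat) = of_nat (Suc l)"
    by simp
  then have "(2 + of_nat l - 1 :: rat) gchoose l = of_nat (Suc l)"
    by (simp only: binomial_gbinomial[symmetric]) simp
  then have "of_int ((- 1) ^ l * int_binomial (- 2) l) = ((- 1) ^ l * (- 1) ^ l * of_nat (Suc l) :: rat)"
    using gbinomial_minus[of "2 :: rat" l] by (simp add: of_int_int_binomial)
  also have "\<dots> = of_int (int (Suc l))"
    by (simp flip: power_mult_distrib)
  finally have "of_int ((- 1) ^ l * int_binomial (- 2) l) = (of_int (int (Suc l)) :: rat)" .
  then show ?thesis
    by (simp only: of_int_eq_iff)
qed

lemma int_binomial_nat: "int_binomial (int n) k = int (n choose k)"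
proof -
  have "of_int (int_binomial (int n) k) = (of_int (int (n choose k)) :: rat)"
    by (simp add: of_int_int_binomial binomial_gbinomial)
  then show ?thesis
    by (simp only: of_int_eq_iff)
qed

text \<open>
  The factor \<open>l + 1\<close> is the one of the annihilation operator
  \<open>b\<^bsub>l+1\<^esub> = c (l + 1) \<partial>/\<partial>b\<^bsub>-(l+1)\<^esub>\<close>. The binomial coefficient is the one of the divided-power
  derivative of the field \<open>b(z)\<close>.
\<close>
lemma heisenberg_matrix_eq:
  "heisenberg_matrix c k l = single (- 2 - int l - int k)
    (c * of_int (int (Suc l)) * of_int (int_binomial (- 2 - int l) k))"
proof -
  have "(- 1) ^ l * of_int (int_binomial (- 2) l) = (of_int (int (Suc l)) :: 'a)"
    unfolding int_binomial_minus_2[symmetric] by simp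
  then show ?thesis
    by (simp add: heisenberg_matrix_def ddx1_single ddx2_single mult.assoc del: of_int_of_nat_eq of_nat_Suc)
qed

text \<open>
  The recursion for the fields is the recursion that defines normally ordered products. The modes of
  \<open>\<partial>\<^sup>kb(z)/k!\<close> with nonnegative exponent of \<open>z\<close> are creation operators whose generating series is the
  Taylor series of the generator; those with negative exponent are the annihilation operators with
  coefficients in row \<open>k\<close> of the matrix of the bicharacter.
\<close>
lemma fls_nth_monomial_field_add_mset:
  fixes c :: "'r::comm_ring_1"
  shows "fls_nth (monomial_field c (add_mset k m) w) N =
    normal_product (dist_deriv k (\<lambda>l. mode c (- l - 1))) (\<lambda>N w. fls_nth (monomial_field c m w) N) N w"
proof -
  let ?a = "dist_deriv k (\<lambda>l. mode c (- l - 1))"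
  let ?E = "fps_to_fls (hasse_series (basis {#k#} :: 'r pi0))"
  define L where "L = (\<Union>n\<in>keys w. set_mset n)"
  have L: "finite L" "\<And>n. n \<in> keys w \<Longrightarrow> set_mset n \<subseteq> L"
    by (auto simp: L_def)
  have partial0: "partial l w = 0" if "l \<notin> L" for l
    unfolding partial_def lin_ext_def
  proof (rule sum.neutral, rule ballI)
    fix n assume "n \<in> keys w"
    then have "count n l = 0"
      using that by (auto simp: L_def not_in_iff)
    then show "smul (lookup w n) (single (n - {#l#}) (of_nat (count n l))) = 0"
      by (simp add: smul_zero)
  qed
  have creation: "Sum_any (\<lambda>j. ?a j (fls_nth (monomial_field c m w) (N - j)) when j \<ge> 0) =
      fls_nth (?E * monomial_field c m w) N"
  proof -
    let ?d = "fls_subdegree (monomial_field c m w)"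
    have a: "?a j v = fls_nth ?E j * v" if j: "j \<ge> 0" for j v
    proof -
      obtain i where i: "j = int i"
        by (rule nonneg_int_cases[OF j])
      have "- (int i + int k) - 1 = - int (Suc (k + i))" "int i + int k = int (k + i)"
        by simp_all
      then have "mode c (- (int i + int k) - 1) v = basis {#k + i#} * v"
        and "int_binomial (int i + int k) k = int ((k + i) choose k)"
        by (simp_all only: mode_neg int_binomial_nat)
      moreover have "(k + i) choose k = (k + i) choose i"
        using binomial_symmetric[of k "k + i"] by simp
      ultimately have "?a j v = of_nat ((k + i) choose i) * (basis {#k + i#} * v)"
        by (simp add: dist_deriv_def i)
      also have "\<dots> = hasse i (basis {#k#}) * v"
        by (simp add: hasse_generator smul_of_nat mult.assoc)
      finally show ?thesis
        by (simp add: i hasse_def)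
    qed
    have "Sum_any (\<lambda>j. ?a j (fls_nth (monomial_field c m w) (N - j)) when j \<ge> 0) =
        Sum_any (\<lambda>j. fls_nth ?E j * fls_nth (monomial_field c m w) (N - j))"
      by (rule arg_cong[where f = Sum_any]) (auto simp: fun_eq_iff when_def a)
    also have "\<dots> = (\<Sum>j = fls_subdegree ?E..N - ?d. fls_nth ?E j * fls_nth (monomial_field c m w) (N - j))"
    proof (rule Sum_any.expand_superset)
      show "{j. fls_nth ?E j * fls_nth (monomial_field c m w) (N - j) \<noteq> 0} \<subseteq> {fls_subdegree ?E..N - ?d}"
      proof
        fix j assume "j \<in> {j. fls_nth ?E j * fls_nth (monomial_field c m w) (N - j) \<noteq> 0}"
        then have "fls_nth ?E j \<noteq> 0" "fls_nth (monomial_field c m w) (N - j) \<noteq> 0"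
          by auto
        then have "\<not> j < fls_subdegree ?E" "\<not> N - j < ?d"
          using fls_eq0_below_subdegree by blast+
        then show "j \<in> {fls_subdegree ?E..N - ?d}"
          by simp
      qed
    qed simp
    also have "\<dots> = fls_nth (?E * monomial_field c m w) N"
      by (rule fls_times_nth(2)[symmetric])
    finally show ?thesis .
  qed
  have annihilation: "Sum_any (\<lambda>j. fls_nth (monomial_field c m (?a j w)) (N - j) when j < 0) =
      (\<Sum>l\<in>L. fls_nth (expansion (heisenberg_matrix c k l) * monomial_field c m (partial l w)) N)"
  proof -
    \<comment> \<open>The exponents that occur: the variable \<open>l\<close> is removed by the mode of \<open>z\<^bsup>-2-l-k\<^esup>\<close>.\<close>
    define J where "J = (\<lambda>l. - 2 - int l - int k) ` L"
    have zero: "monomial_field c m 0 = 0"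
      by (rule additive.zero[OF additive_monomial_field])
    have a: "?a (- 2 - int l - int k) w =
        smul (c * of_int (int (Suc l)) * of_int (int_binomial (- 2 - int l) k)) (partial l w)" for l
    proof -
      have "mode c (int (Suc l)) w = smul (c * of_int (int (Suc l))) (partial l w)"
        by (simp add: mode_def nat_add_distrib)
      moreover have "?a (- 2 - int l - int k) w =
          smul (of_int (int_binomial (- 2 - int l) k)) (mode c (int (Suc l)) w)"
      proof -
        have "- 2 - int l - int k + int k = - 2 - int l" "- (- 2 - int l) - 1 = int (Suc l)"
          by simp_all
        then show ?thesis
          by (simp only: dist_deriv_def smul_of_int)
      qed
      ultimately show ?thesis
        by (simp only: smul_smul mult_ac)
    qed
    \<comment> \<open>The binomial coefficient vanishes for \<open>-k \<le> j < 0\<close>, the mode \<open>b\<^sub>0\<close> for \<open>j = -k - 1\<close>, and the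
      derivative of \<open>w\<close> in the remaining cases.\<close>
    have outside: "?a j w = 0" if "j < 0" "j \<notin> J" for j
    proof (cases "j + int k \<ge> 0")
      case True
      then obtain i where "j + int k = int i"
        by (metis nonneg_int_cases)
      moreover from this \<open>j < 0\<close> have "int_binomial (int i) k = 0"
        by (simp add: int_binomial_nat binomial_eq_0)
      ultimately show ?thesis
        by (simp add: dist_deriv_def)
    next
      case False
      have "mode c (- (j + int k) - 1) w = 0"
      proof (cases "j + int k = - 1")
        case True
        then show ?thesis
          by (simp add: mode_def smul_def)
      next
        case neq: False
        define l where "l = nat (- (j + int k) - 2)"
        have l: "j = - 2 - int l - int k"
          using False neq by (simp add: l_def)
        with that have "l \<notin> L"
          by (auto simp: J_def)
        then show ?thesis
          using partial0 by (simp add: mode_def l nat_add_distrib smul_zero)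
      qed
      then show ?thesis
        by (simp add: dist_deriv_def)
    qed
    have "Sum_any (\<lambda>j. fls_nth (monomial_field c m (?a j w)) (N - j) when j < 0) =
        (\<Sum>j\<in>J. fls_nth (monomial_field c m (?a j w)) (N - j) when j < 0)"
    proof (rule Sum_any.expand_superset)
      show "finite J"
        using L(1) by (simp add: J_def)
      have "(fls_nth (monomial_field c m (?a j w)) (N - j) when j < 0) = 0" if "j \<notin> J" for j
        using outside[of j] that zero by (cases "j < 0") simp_all
      then show "{j. (fls_nth (monomial_field c m (?a j w)) (N - j) when j < 0) \<noteq> 0} \<subseteq> J"
        by blast
    qed
    also have "\<dots> = (\<Sum>l\<in>L. fls_nth (monomial_field c m (?a (- 2 - int l - int k) w)) (N - (- 2 - int l - int k)))"
      unfolding J_def by (subst sum.reindex) (auto simp: inj_on_def)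
    also have "\<dots> = (\<Sum>l\<in>L. fls_nth (expansion (heisenberg_matrix c k l) * monomial_field c m (partial l w)) N)"
      unfolding a monomial_field_smul heisenberg_matrix_eq expansion_single
      by (simp only: scalar_X_intpow_mult_nth scalar_mult_nth)
    finally show ?thesis .
  qed
  show ?thesis
    unfolding normal_product_def creation annihilation
    by (subst monomial_field_add_mset[OF L], assumption) (simp only: fls_plus_nth fls_nth_sum)
qed

lemma state_field_normal_products:
  assumes "\<forall>n\<in>set ns. n \<ge> 1"
  shows "fls_nth (state_field c (\<Prod>i\<leftarrow>ns. bneg i) w) N =
    normal_products (map (\<lambda>i. dist_deriv (i - 1) (\<lambda>l. mode c (- l - 1))) ns) N w"
proof -
  have "(\<Prod>i\<leftarrow>ns. bneg i :: 'a pi0) = basis (mset (map (\<lambda>i. i - 1) ns))"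
    by (induction ns) (simp_all add: bneg_def mult_single)
  moreover have "fls_nth (monomial_field c (mset (map (\<lambda>i. i - 1) ns)) w) N =
      normal_products (map (\<lambda>i. dist_deriv (i - 1) (\<lambda>l. mode c (- l - 1))) ns) N w"
  proof (induction ns arbitrary: N w)
    case Nil
    show ?case
      by (simp add: normal_products_def identity_field_def monomial_field_empty)
  next
    case (Cons i ns)
    then show ?case
      by (simp add: normal_products_def fls_nth_monomial_field_add_mset)
  qed
  ultimately show ?thesis
    by (simp add: state_field_basis)
qed

definition heisenberg_va :: "'r \<Rightarrow> 'r::comm_ring_1 pi0 vertex_data"
  where "heisenberg_va c = \<lparr>va_vac = 1, va_transl = hasse 1, va_field = state_field c\<rparr>"

lemma is_heisenberg_va_heisenberg_va: "is_heisenberg_va c (heisenberg_va c)"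
  unfolding is_heisenberg_va_def heisenberg_va_def
  by (rule exI[of _ "mode c"])
    (use state_field_normal_products in \<open>auto simp: heisenberg_modes_mode hasse_linear hasse_one
      hasse_1_mode[simplified] linear_map_state_field\<close>)

text \<open>
  The modes and the translation operator are determined by their commutators, and the fields of
  monomials, hence all fields, by the modes.
\<close>
lemma is_heisenberg_va_unique:
  assumes W: "is_heisenberg_va c W"
  shows "W = heisenberg_va c"
proof -
  obtain b where b: "heisenberg_modes c b" and vac: "va_vac W = 1"
    and t: "linear_map (va_transl W)" "va_transl W 1 = 0"
      "\<And>n w. va_transl W (b n w) - b n (va_transl W w) = - (of_int n * b (n - 1) w)"
    and lin: "\<And>w n. linear_map (\<lambda>u. fls_nth (va_field W u w) n)"
    and products: "\<And>ns w n. \<forall>n\<in>set ns. n \<ge> 1 \<Longrightarrow>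
      fls_nth (va_field W (\<Prod>i\<leftarrow>ns. bneg i) w) n =
        normal_products (map (\<lambda>i. dist_deriv (i - 1) (\<lambda>l. b (- l - 1))) ns) n w"
    using W unfolding is_heisenberg_va_def by blast
  have b: "b = mode c"
    by (rule heisenberg_modes_unique[OF b])
  have transl: "va_transl W = hasse 1"
    by (rule translation_unique[OF t[unfolded b]])
  have "va_field W u w = state_field c u w" for u w
  proof (rule fls_eqI)
    fix n
    show "fls_nth (va_field W u w) n = fls_nth (state_field c u w) n"
    proof (rule linear_map_eqI[OF lin linear_map_state_field])
      fix m :: "nat multiset"
      obtain ks where ks: "m = mset ks"
        using ex_mset by metis
      have "(\<Prod>i\<leftarrow>map Suc ks. bneg i :: 'a pi0) = basis m"
        unfolding ks by (induction ks) (simp_all add: bneg_def mult_single)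
      then show "fls_nth (va_field W (basis m) w) n = fls_nth (state_field c (basis m) w) n"
        using products[of "map Suc ks" w n] state_field_normal_products[of "map Suc ks" c w n] b by simp
    qed
  qed
  then have "va_field W = state_field c"
    by blast
  with vac transl show ?thesis
    by (simp add: heisenberg_va_def)
qed

section \<open>The vertex algebra associated to the twisted algebra\<close>

text \<open>
  Without this, the positions \<open>1\<close> and \<open>2\<close> of the two tensor factors are simplified to different
  kinds of terms.
\<close>
lemmas [simp del] = One_nat_def

lemma additive_dloc_const: "additive dloc_const"
  by (simp add: additive_def dloc_const_def dfrac_add denoms_one single_add)

lemma dloc_const_mult: "dloc_const (a * b) = dloc_const a * dloc_const b"
  by (simp add: dloc_const_def dfrac_mult denoms_one mult_single)

lemma dloc_const_one: "dloc_const 1 = 1"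
  by (simp add: dloc_const_def dfrac_one)

lemma laurent_subst_eq_semilin: "laurent_subst i j = semilin dloc_const (diff_pow i j)"
  by (simp add: fun_eq_iff laurent_subst_def semilin_def)

lemma additive_laurent_subst: "additive (laurent_subst i j)"
  unfolding laurent_subst_eq_semilin by (rule additive_semilin[OF additive_dloc_const])

lemma denoms_power: "i \<noteq> j \<Longrightarrow> (xvar i - xvar j) ^ n \<in> denoms"
  by (induction n) (auto intro: denoms.intros)

text \<open>
  \<^const>\<open>coeff_at_0\<close> inverts the substitution \<open>x\<^sub>1 \<rightarrow> x\<^sub>i\<close>, \<open>x\<^sub>2 \<rightarrow> x\<^sub>j\<close>, so it has to be injective. After
  multiplication by a power of \<open>x\<^sub>i - x\<^sub>j\<close> the image is a polynomial in \<open>x\<^sub>i - x\<^sub>j\<close>, and evaluating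
  it at \<open>x\<^sub>j = 0\<close> exhibits the coefficients.
\<close>
lemma laurent_subst_eq_0:
  assumes ij: "i \<noteq> j" and f: "laurent_subst i j f = 0"
  shows "f = (0 :: 'r::comm_ring_1 laurent)"
proof -
  let ?d = "xvar i - xvar j :: (nat, 'r) mpoly"
  \<comment> \<open>\<open>N\<close> clears all denominators of \<open>f\<close>.\<close>
  obtain N where N: "n + int N \<ge> 0" if "n \<in> keys f" for n
  proof
    fix n assume "n \<in> keys f"
    then have "Min (insert 0 (keys f)) \<le> n" "Min (insert 0 (keys f)) \<le> 0"
      by simp_all
    then show "n + int (nat (- Min (insert 0 (keys f)))) \<ge> 0"
      by linarith
  qed
  have clear: "diff_pow i j n * dfrac (?d ^ N) 1 = dfrac (?d ^ nat (n + int N)) 1"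
    if "n + int N \<ge> 0" for n
  proof (cases "n \<ge> 0")
    case True
    then show ?thesis
      using that by (simp add: diff_pow_def dfrac_mult denoms_one nat_add_distrib power_add)
  next
    case False
    then have "N = nat (n + int N) + nat (- n)"
      using that by linarith
    then have "?d ^ N = ?d ^ nat (n + int N) * ?d ^ nat (- n)"
      by (metis power_add)
    then show ?thesis
      using False by (simp add: diff_pow_def dfrac_mult denoms_one denoms_power ij dfrac_eq)
  qed
  define P where "P = (\<Sum>n\<in>keys f. single 0 (lookup f n) * ?d ^ nat (n + int N))"
  have additive_frac: "additive (\<lambda>p. dfrac p 1 :: 'r dloc)"
    by (simp add: additive_def dfrac_add denoms_one)
  have "dfrac P 1 = laurent_subst i j f * dfrac (?d ^ N) 1"
    using N by (simp add: P_def additive.sum[OF additive_frac] laurent_subst_def sum_distrib_right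
        mult.assoc clear) (simp add: dloc_const_def dfrac_mult denoms_one)
  then have "dfrac P 1 = dfrac 0 1"
    by (simp only: f mult_zero_left dfrac_zero[symmetric])
  then have "P = 0"
    using dfrac_eq[of 1 1 P 0] by (simp add: denoms_one)
  \<comment> \<open>The evaluation \<open>x\<^sub>i = X\<close>, \<open>x\<^sub>j = 0\<close>.\<close>
  define \<phi> :: "nat \<Rightarrow> 'r fps" where "\<phi> k = (if k = i then fps_X else 0)" for k
  let ?ev = "mpoly_eval fps_const \<phi>"
  have add: "additive ?ev"
    by standard (rule mpoly_eval_add; simp)
  have mult: "?ev (p * q) = ?ev p * ?ev q" for p q
    by (rule mpoly_eval_mult; simp)
  have d: "?ev ?d = fps_X"
    using ij by (simp add: additive.diff[OF add] mpoly_eval_single \<phi>_def)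
  have one: "?ev 1 = 1"
    using mpoly_eval_single[of fps_const \<phi> "{#}" 1] by simp
  have "?ev (?d ^ n) = fps_X ^ n" for n
    by (induction n) (simp_all add: mult d one)
  then have "(\<Sum>n\<in>keys f. fps_const (lookup f n) * fps_X ^ nat (n + int N)) = ?ev P"
    by (simp add: P_def additive.sum[OF add] mult mpoly_eval_single)
  also have "\<dots> = 0"
    by (simp add: \<open>P = 0\<close> additive.zero[OF add])
  finally have 0: "(\<Sum>n\<in>keys f. fps_const (lookup f n) * fps_X ^ nat (n + int N)) = (0 :: 'r fps)" .
  show ?thesis
  proof (rule poly_mapping_eqI)
    fix k
    show "lookup f k = lookup 0 k"
    proof (cases "k \<in> keys f")
      case True
      have "fps_nth (\<Sum>n\<in>keys f. fps_const (lookup f n) * fps_X ^ nat (n + int N)) (nat (k + int N)) =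
          (\<Sum>n\<in>keys f. if n = k then lookup f n else 0)"
        unfolding fps_sum_nth
      proof (rule sum.cong)
        fix n assume "n \<in> keys f"
        then have "nat (k + int N) = nat (n + int N) \<longleftrightarrow> n = k"
          using N[of n] N[OF True] by linarith
        then show "fps_nth (fps_const (lookup f n) * fps_X ^ nat (n + int N)) (nat (k + int N)) =
            (if n = k then lookup f n else 0)"
          by (simp add: fps_X_power_nth)
      qed simp
      with 0 True show ?thesis
        by simp
    qed (simp add: in_keys_iff)
  qed
qed

lemma inj_laurent_subst:
  assumes "i \<noteq> j"
  shows "inj (laurent_subst i j)"
proof (rule injI)
  fix f g :: "'a laurent"
  assume "laurent_subst i j f = laurent_subst i j g"
  then have "laurent_subst i j (f - g) = 0"
    by (simp add: additive.diff[OF additive_laurent_subst])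
  then show "f = g"
    using laurent_subst_eq_0[OF assms] by fastforce
qed

lemma coeff_at_0_laurent_subst: "coeff_at_0 (laurent_subst 1 2 f) = expansion f"
  by (simp add: coeff_at_0_def inv_f_f inj_laurent_subst expansion_def semilin_def scalar_def)

text \<open>
  With one point on either side, the iterated coproducts in the pairing of tensors are trivial.
\<close>
lemma iter_coprod_single: "iter_coprod [j] (basis m) = basis (single j m)"
  by (simp only: iter_coprod.simps lin_ext_pi0_coprod place_basis pi0_counit_basis single_counit
      sweedler_counit')

lemma bichar_ext_single:
  fixes r :: "'r::comm_ring_1 pi0 \<Rightarrow> 'r pi0 \<Rightarrow> 'r laurent"
  assumes "heisenberg_bicharacter c r"
  shows "bichar_ext r {1} {2} (single 1 p) (single 2 q) =
    laurent_subst 1 2 (pairing (heisenberg_matrix c) p q)"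
proof -
  have "r (basis p) (basis q) = pairing (heisenberg_matrix c) p q"
    by (rule heisenberg_bicharacter_basis[OF assms])
  then show ?thesis
    by (simp add: bichar_ext_def iter_coprod_single dloc_const_one del: iter_coprod.simps)
qed

lemma linear_map_tens_coprod: "linear_map tens_coprod"
  unfolding tens_coprod_def by (rule linear_map_lin_ext)

lemma tens_coprod_place:
  "tens_coprod (place i (single m a)) =
    smul a (sweedler m (\<lambda>p q. basis (single i p, single i q)))"
proof -
  have "tens_coprod (basis (single i m) :: ('a, 'b) tens) =
      sweedler m (\<lambda>p q. basis (single i p, single i q))"
  proof -
    have "tens_coprod (basis (single i m) :: ('a, 'b) tens) = (\<Prod>j\<in>keys (single i m).
        sweedler (lookup (single i m) j) (\<lambda>p q. basis (single j p, single j q)))"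
      by (simp only: tens_coprod_def lin_ext_single smul_one lin_ext_pi0_coprod)
    then show ?thesis
      by (cases "m = {#}") (simp_all flip: zero_prod_def)
  qed
  moreover have "place i (single m a) = smul a (basis (single i m))"
    by (simp add: place_def lin_ext_single)
  ultimately show ?thesis
    by (simp add: linear_map_scale[OF linear_map_tens_coprod])
qed

text \<open>
  The singular product on \<open>V({1}) \<otimes> V({2})\<close>, with coefficients in \<open>R[(x\<^sub>1 - x\<^sub>2)\<^sup>\<plusminus>\<^sup>1]\<close> before they
  are carried to \<open>S\<^sub>0({1} : {2})\<close>. In this form it is visible that all its coefficients are values of
  \<^const>\<open>laurent_subst\<close>, on which \<^const>\<open>coeff_at_0\<close> is meaningful.
\<close>
definition twisted_monomial :: "'r \<Rightarrow> nat multiset \<Rightarrow> nat multiset \<Rightarrow> (nat, 'r::comm_ring_1 laurent) tens"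
  where "twisted_monomial c m n = sweedler m (\<lambda>p q. sweedler n (\<lambda>s t.
    single (single 1 p + single 2 s) (pairing (heisenberg_matrix c) q t)))"

definition twisted_laurent :: "'r \<Rightarrow> 'r pi0 \<Rightarrow> 'r pi0 \<Rightarrow> (nat, 'r::comm_ring_1 laurent) tens"
  where "twisted_laurent c u w =
    semilin (\<lambda>a. single 0 (single 0 a)) (\<lambda>m. semilin (\<lambda>a. single 0 (single 0 a)) (twisted_monomial c m) w) u"

abbreviation subst_coeffs :: "(nat, 'r::comm_ring_1 laurent) tens \<Rightarrow> (nat, 'r dloc) tens"
  where "subst_coeffs \<equiv> Poly_Mapping.map (laurent_subst 1 2)"

lemma laurent_subst_0 [simp]: "laurent_subst i j 0 = 0"
  by (rule additive.zero[OF additive_laurent_subst])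

lemma lookup_subst_coeffs: "lookup (subst_coeffs t) k = laurent_subst 1 2 (lookup t k)"
  by (simp add: Poly_Mapping.map.rep_eq when_def)

lemma additive_subst_coeffs: "additive subst_coeffs"
  by (simp add: additive_def poly_mapping_eq_iff fun_eq_iff lookup_subst_coeffs lookup_add
      additive.add[OF additive_laurent_subst])

lemma subst_coeffs_single: "subst_coeffs (single k f) = single k (laurent_subst 1 2 f)"
  by (rule poly_mapping_eqI) (simp add: lookup_subst_coeffs lookup_single when_def)

lemma subst_coeffs_scalar:
  "subst_coeffs (single 0 (single 0 a) * t) = single 0 (dloc_const a) * subst_coeffs t"
proof (rule additive_eqI[where f = "\<lambda>t. subst_coeffs (single 0 (single 0 a) * t)"
      and g = "\<lambda>t. single 0 (dloc_const a) * subst_coeffs t"])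
  fix k f
  have "laurent_subst 1 2 (single 0 a * f) = dloc_const a * laurent_subst 1 2 f"
    unfolding laurent_subst_eq_semilin smul_def[symmetric]
    by (rule semilin_smul[OF additive_dloc_const]) (rule dloc_const_mult)
  then show "subst_coeffs (single 0 (single 0 a) * single k f) =
      single 0 (dloc_const a) * subst_coeffs (single k f)"
    by (simp add: mult_single subst_coeffs_single)
qed (intro additive_comp[OF additive_subst_coeffs] additive_comp[OF additive_mult_const(1)]
    additive_mult_const additive_subst_coeffs)+

lemma additive_constants:
  "additive (\<lambda>a. single 0 (single 0 a))" "additive (\<lambda>a. single 0 (dloc_const a))"
  by (simp_all add: additive_def single_add additive.add[OF additive_dloc_const])

text \<open>
  Both sides are additive in \<open>u\<close> and in \<open>w\<close>, so it suffices to compare them on multiples of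
  monomials. There the coproducts become Sweedler sums.
\<close>
lemma twisted_mult_eq:
  assumes "heisenberg_bicharacter c r"
  shows "twisted_mult r {1} {2} (place 1 u) (place 2 w) = subst_coeffs (twisted_laurent c u w)"
proof -
  let ?\<iota> = "\<lambda>a. single 0 (dloc_const a) :: (nat, 'a dloc) tens"
  let ?\<kappa> = "\<lambda>a. single 0 (single 0 a) :: (nat, 'a laurent) tens"
  let ?B = "\<lambda>u' u'' w' w''. single (u' + w') (bichar_ext r {1} {2} u'' w'')"
  let ?M = "\<lambda>u w. semilin ?\<iota> (\<lambda>(u', u''). semilin ?\<iota> (\<lambda>(w', w''). ?B u' u'' w' w'')
    (tens_coprod (place 2 w))) (tens_coprod (place 1 u))"
  have mult: "?\<iota> (a * b) = ?\<iota> a * ?\<iota> b" for a b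
    by (simp add: mult_single dloc_const_mult)
  note \<iota> = additive_constants(2) mult
  note coprod = additive_comp[OF additive_semilin[OF \<iota>(1)]
      additive_comp[OF linear_map_additive[OF linear_map_tens_coprod]
        linear_map_additive[OF linear_map_place]]]
  have semilin_sweedler: "semilin ?\<iota> (\<lambda>(x, y). F x y) (tens_coprod (place i (single m a))) =
      ?\<iota> a * sweedler m (\<lambda>p q. F (single i p) (single i q))" for F and i :: nat and m a
    by (simp add: tens_coprod_place semilin_smul[OF \<iota>]
        sweedler_additive[OF additive_semilin[OF \<iota>(1)]] semilin_single[OF \<iota>(1)] dloc_const_one)
  have "twisted_mult r {1} {2} (place 1 u) (place 2 w) = ?M u w"
    by (simp add: twisted_mult_def semilin_def sum_distrib_left case_prod_unfold mult_single
        dloc_const_mult mult.assoc)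
  also have "?M u w = subst_coeffs (twisted_laurent c u w)"
  proof (rule additive_eqI[where f = "\<lambda>u. ?M u w"])
    show "additive (\<lambda>u. subst_coeffs (twisted_laurent c u w))"
      unfolding twisted_laurent_def
      by (intro additive_comp[OF additive_subst_coeffs] additive_semilin additive_constants)
    fix m a
    show "?M (single m a) w = subst_coeffs (twisted_laurent c (single m a) w)"
    proof (rule additive_eqI[where f = "?M (single m a)"])
      show "additive (\<lambda>w. subst_coeffs (twisted_laurent c (single m a) w))"
        unfolding twisted_laurent_def semilin_single[OF additive_constants(1)]
        by (intro additive_comp[OF additive_subst_coeffs] additive_comp[OF additive_mult_const(1)]
            additive_semilin additive_constants)
      show "additive (?M (single m a))"
        unfolding semilin_sweedler sweedler_swap
        by (intro additive_comp[OF additive_mult_const(1)]) (simp add: additive_def sweedler_add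
            additive.add[OF coprod])
      fix n b
      have "?M (single m a) (single n b) = ?\<iota> a * (?\<iota> b * sweedler m (\<lambda>p q. sweedler n (\<lambda>s t.
          ?B (single 1 p) (single 1 q) (single 2 s) (single 2 t))))"
        by (simp only: semilin_sweedler sweedler_mult(1))
      also have "\<dots> = ?\<iota> a * (?\<iota> b * subst_coeffs (twisted_monomial c m n))"
        by (simp add: bichar_ext_single[OF assms] twisted_monomial_def subst_coeffs_single
            sweedler_additive[OF additive_subst_coeffs])
      also have "\<dots> = subst_coeffs (twisted_laurent c (single m a) (single n b))"
        by (simp only: twisted_laurent_def semilin_single[OF additive_constants(1)] subst_coeffs_scalar)
      finally show "?M (single m a) (single n b) =
          subst_coeffs (twisted_laurent c (single m a) (single n b))" .
    qed
  qed (rule coprod)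
  finally show ?thesis .
qed

text \<open>
  Setting \<open>x\<^sub>2 = 0\<close> leaves the second factor unchanged, as \<open>D\<^sup>(\<^sup>0\<^sup>) = id\<close>.
\<close>
lemma taylor_at_0:
  fixes r :: "'r::comm_ring_1 pi0 \<Rightarrow> 'r pi0 \<Rightarrow> 'r laurent"
  shows "fps_to_fls (fps_nth (taylor (twisted_algebra r) (basis (single 1 p + single 2 s))) 0) =
    fps_to_fls (hasse_series (basis p)) * fls_const (basis s)"
proof -
  have "basis (single 1 p + single 2 s) = place (1 :: nat) (basis p) * place 2 (basis s :: 'r pi0)"
    by (simp add: place_basis mult_single)
  then have "fps_nth (taylor (twisted_algebra r) (basis (single 1 p + single 2 s))) 0 =
      hasse_series (basis p) * fps_const (basis s)"
    by (intro fps_ext) (simp add: taylor_tensor hasse_0 flip: hasse_def)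
  then show ?thesis
    by (simp add: fls_times_fps_to_fls)
qed

lemma associated_va_field:
  assumes "heisenberg_bicharacter c r"
  shows "va_field (associated_va (twisted_algebra r)) u w = state_field c u w"
proof -
  let ?T = "\<lambda>k. fps_to_fls (fps_nth (taylor (twisted_algebra r) (basis k)) 0)"
  have keys: "keys (subst_coeffs t) = keys t" for t :: "(nat, 'a laurent) tens"
  proof -
    have "laurent_subst 1 2 (lookup t k) = 0 \<longleftrightarrow> lookup t k = 0" for k
      using laurent_subst_eq_0[of 1 2 "lookup t k"] by auto
    then show ?thesis
      by (simp add: set_eq_iff in_keys_iff lookup_subst_coeffs)
  qed
  note add = additive_comp[OF additive_semilin[OF additive_expansion]]
  have scale: "semilin expansion ?T (single 0 (single 0 a) * t) = scalar a * semilin expansion ?T t" for a t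
    using semilin_smul[OF additive_expansion expansion_mult, of ?T "single 0 a" t]
    by (simp add: smul_def expansion_single)
  have "va_field (associated_va (twisted_algebra r)) u w =
      (\<Sum>k\<in>keys (subst_coeffs (twisted_laurent c u w)).
        ?T k * coeff_at_0 (lookup (subst_coeffs (twisted_laurent c u w)) k))"
    by (simp add: associated_va_def twisted_algebra_def twisted_mult_eq[OF assms] Let_def)
  also have "\<dots> = semilin expansion ?T (twisted_laurent c u w)"
    by (simp add: keys semilin_def lookup_subst_coeffs coeff_at_0_laurent_subst mult.commute)
  also have "\<dots> = state_field c u w"
  proof (rule additive_eqI[where f = "\<lambda>u. semilin expansion ?T (twisted_laurent c u w)"
        and g = "\<lambda>u. state_field c u w"])
    show "additive (\<lambda>u. semilin expansion ?T (twisted_laurent c u w))"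
      unfolding twisted_laurent_def by (intro add additive_semilin additive_constants)
    show "additive (\<lambda>u. state_field c u w)"
      unfolding state_field_def by (intro additive_semilin additive_scalar)
    fix m a
    show "semilin expansion ?T (twisted_laurent c (single m a) w) = state_field c (single m a) w"
    proof (rule additive_eqI[where g = "\<lambda>w. state_field c (single m a) w"
          and f = "\<lambda>w. semilin expansion ?T (twisted_laurent c (single m a) w)"])
      show "additive (\<lambda>w. semilin expansion ?T (twisted_laurent c (single m a) w))"
        unfolding twisted_laurent_def semilin_single[OF additive_constants(1)]
        by (intro add additive_comp[OF additive_mult_const(1)] additive_semilin additive_constants)
      show "additive (state_field c (single m a))"
        unfolding state_field_def semilin_single[OF additive_scalar]
        by (intro additive_comp[OF additive_mult_const(1)] additive_monomial_field)
      fix n b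
      have "semilin expansion ?T (twisted_monomial c m n) = monomial_field_basis c m n"
        by (simp add: twisted_monomial_def monomial_field_basis_def taylor_at_0 mult_ac
            sweedler_additive[OF additive_semilin[OF additive_expansion]]
            semilin_single[OF additive_expansion])
      then show "semilin expansion ?T (twisted_laurent c (single m a) (single n b)) =
          state_field c (single m a) (single n b)"
        by (simp add: twisted_laurent_def state_field_def monomial_field_def
            semilin_single[OF additive_constants(1)] semilin_single[OF additive_scalar] scale)
    qed
  qed
  finally show ?thesis .
qed

lemma associated_va_eq:
  assumes "heisenberg_bicharacter c r"
  shows "associated_va (twisted_algebra r) = heisenberg_va c"
proof -
  have "place j (1 :: 'a pi0) = 1" for j :: nat
    using place_basis[of j "{#}"] by simp
  then have "tens_hasse (1 :: nat) 1 (place 1 u) = place 1 (hasse 1 u)" for u :: "'a pi0"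
    using tens_hasse_place[of "1 :: nat" 2 1 u 1] by simp
  then have "va_transl (associated_va (twisted_algebra r)) = hasse 1"
    by (simp add: fun_eq_iff associated_va_def twisted_algebra_def unplace_place)
  moreover have "va_field (associated_va (twisted_algebra r)) = state_field c"
    by (intro ext associated_va_field[OF assms])
  moreover have "va_vac (associated_va (twisted_algebra r)) = 1"
    by (simp add: associated_va_def)
  ultimately show ?thesis
    by (simp add: heisenberg_va_def)
qed

theorem proposition3p4:
  fixes c :: "'r::comm_ring_1"
  shows "(\<exists>!r. bicharacter r \<and> Ha_invariant r \<and> r (bneg 1) (bneg 1) = single (- 2) c) \<and>
    (\<exists>!W. is_heisenberg_va c W) \<and>
    (\<forall>r W. bicharacter r \<and> Ha_invariant r \<and> r (bneg 1) (bneg 1) = single (- 2) c \<and>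
      is_heisenberg_va c W \<longrightarrow> associated_va (twisted_algebra r) = W)"
proof (intro conjI allI impI)
  show "\<exists>!r. bicharacter r \<and> Ha_invariant r \<and> r (bneg 1) (bneg 1) = single (- 2) c"
    using heisenberg_bicharacter_bichar_of[of c] heisenberg_bicharacter_unique[of c]
    unfolding heisenberg_bicharacter_def by (rule ex1I)
  show "\<exists>!W. is_heisenberg_va c W"
    using is_heisenberg_va_heisenberg_va[of c] is_heisenberg_va_unique[of c] by (rule ex1I)
  fix r W
  assume "bicharacter r \<and> Ha_invariant r \<and> r (bneg 1) (bneg 1) = single (- 2) c \<and>
    is_heisenberg_va c W"
  then have "heisenberg_bicharacter c r" "is_heisenberg_va c W"
    by (simp_all add: heisenberg_bicharacter_def)
  then show "associated_va (twisted_algebra r) = W"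
    using associated_va_eq is_heisenberg_va_unique by metis
qed

end
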